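(* There is an algorithm which, given integers $n\ge1$, $M\ge 0$ and a vector $a=(a_0,\dots,a_n)\in\mathbb{Z}^{n+1}$ with $0\le a_i\le M$ for $0\le i\le n$ and $a_0=a_n=0$, decides whether there exists a non-periodic tropical recurrent minimal sequence satisfying $a$. The complexity of the algorithm does not exceed $(Mn)^{O(n)}$.
   Context: A tropical recurrent sequence here is a sequence $y=(y_j)_{j\in\mathbb{Z}}$ of real numbers. It satisfies $a$ if for every $k\in\mathbb{Z}$ the minimum $\min_{0\le i\le n}\{a_i+y_{i+k}\}$ is attained for at least two different indices $i$. It is minimal if for every $j\in\mathbb{Z}$ there exists $k$ with $j-n\le k\le j$ such that $a_{j-k}+y_j=\min_{0\le i\le n}\{a_i+y_{i+k}\}$. The sequence is periodic if there is $d\ge1$ with $y_{j+d}=y_j$ for all $j\in\mathbb{Z}$; otherwise it is non-periodic.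
   Formalization: The complexity bound is stated as max(2, Mn)^{O(n)} steps of a random access machine with integer registers, because for M = 0 (and for M = n = 1) the literal bound (Mn)^{O(n)} degenerates to 0 (or 1); for Mn ≥ 2 the bound is unchanged. *)

theory Defs
  imports Complex_Main
begin

text \<open>The vector a = (a_0,...,a_n) is represented by a function nat => int, of which
only the values at 0..n are used. Sequences y are functions int => real.\<close>

definition trop_min :: "nat \<Rightarrow> (nat \<Rightarrow> int) \<Rightarrow> (int \<Rightarrow> real) \<Rightarrow> int \<Rightarrow> real" where
  "trop_min n a y k = Min ((\<lambda>i. real_of_int (a i) + y (int i + k)) ` {0..n})"

definition satisfies :: "nat \<Rightarrow> (nat \<Rightarrow> int) \<Rightarrow> (int \<Rightarrow> real) \<Rightarrow> bool" where
  "satisfies n a y \<longleftrightarrow>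
     (\<forall>k::int. \<exists>i j. i \<le> n \<and> j \<le> n \<and> i \<noteq> j \<and>
        real_of_int (a i) + y (int i + k) = trop_min n a y k \<and>
        real_of_int (a j) + y (int j + k) = trop_min n a y k)"

definition minimal_seq :: "nat \<Rightarrow> (nat \<Rightarrow> int) \<Rightarrow> (int \<Rightarrow> real) \<Rightarrow> bool" where
  "minimal_seq n a y \<longleftrightarrow>
     (\<forall>j::int. \<exists>k::int. j - int n \<le> k \<and> k \<le> j \<and>
        real_of_int (a (nat (j - k))) + y j = trop_min n a y k)"

definition periodic_seq :: "(int \<Rightarrow> real) \<Rightarrow> bool" where
  "periodic_seq y \<longleftrightarrow> (\<exists>d::int. d \<ge> 1 \<and> (\<forall>j. y (j + d) = y j))"

datatype instr =
    Const int int
  | Add int int int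
  | Sub int int int
  | Load int int
  | Store int int
  | Jle0 int nat
  | Jmp nat
  | Halt

type_synonym prog = "instr list"
type_synonym state = "nat \<times> (int \<Rightarrow> int)"

definition halted :: "prog \<Rightarrow> state \<Rightarrow> bool" where
  "halted P s \<longleftrightarrow> fst s \<ge> length P \<or> P ! fst s = Halt"

definition step :: "prog \<Rightarrow> state \<Rightarrow> state" where
  "step P s = (if halted P s then s else
     (let pc = fst s; R = snd s in
      case P ! pc of
        Const r c \<Rightarrow> (pc + 1, R(r := c))
      | Add r x z \<Rightarrow> (pc + 1, R(r := R x + R z))
      | Sub r x z \<Rightarrow> (pc + 1, R(r := R x - R z))
      | Load r x \<Rightarrow> (pc + 1, R(r := R (R x)))
      | Store r x \<Rightarrow> (pc + 1, R(R r := R x))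
      | Jle0 r l \<Rightarrow> (if R r \<le> 0 then (l, R) else (pc + 1, R))
      | Jmp l \<Rightarrow> (l, R)
      | Halt \<Rightarrow> s))"

definition input_regs :: "nat \<Rightarrow> int \<Rightarrow> (nat \<Rightarrow> int) \<Rightarrow> int \<Rightarrow> int" where
  "input_regs n M a r =
     (if r = 0 then int n else if r = 1 then M
      else if 2 \<le> r \<and> r \<le> int n + 2 then a (nat (r - 2)) else 0)"

text \<open>P, started on the given registers, halts within t steps with output register 0.\<close>
definition halts_within :: "prog \<Rightarrow> (int \<Rightarrow> int) \<Rightarrow> nat \<Rightarrow> (int \<Rightarrow> int) \<Rightarrow> bool" where
  "halts_within P R0 t Rf \<longleftrightarrow>
     (halted P ((step P ^^ t) (0, R0)) \<and> snd ((step P ^^ t) (0, R0)) = Rf)"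

end

theory Submission
  imports Defs
begin

text \<open>A solution \<open>y\<close> is bounded: the window minima \<open>m k\<close> change by at most \<open>M\<close> from one \<open>k\<close> to the
next, and \<open>a 0 = a n = 0\<close> together with the second index attaining the minimum yields, to the right and
to the left of \<open>k\<close>, indices at distance at most \<open>n\<close> whose minimum does not exceed \<open>m k\<close>. Hence
\<open>y\<close> oscillates by at most \<open>M (n + 1)\<close>. Since rounding down commutes with the tropical operations, each
\<open>\<lfloor>y + t\<rfloor>\<close> is, up to a constant, a solution over \<open>b = M (n + 1) + 1\<close> digits. Such solutions are the
bi-infinite walks in a finite graph whose vertices are the locally valid words of length \<open>2 n + 1\<close>, and
every word on a bi-infinite walk survives the repeated deletion of words without predecessor or without
successor. If two surviving words share a successor, then two walks with a common future differ, and they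
cannot both be periodic. Otherwise all integer solutions have the common period \<open>fact N\<close>, where \<open>N\<close>
is the number of words; this applies to all \<open>\<lfloor>y + t\<rfloor>\<close>, so \<open>y\<close> itself is periodic.

The deletion is performed by a program in a small structured language that is compiled to the machine.
A loop rule that bounds the number of iterations of each loop by \<open>Z\<close> makes the running time a polynomial
in \<open>Z\<close> that depends only on the program text.\<close>

section \<open>Structured programs\<close>

type_synonym regs = "int \<Rightarrow> int"

datatype com =
    Blk "instr list"
  | Seq com com  (infixr ";;" 60)
  | If0 int com com
  | While int com

text \<open>Instructions after which control falls through to the next address. Excluding
  \<open>Halt\<close> ensures that a block never stops before its end.\<close>

fun basic :: "instr \<Rightarrow> bool" where
  "basic (Jle0 _ _) = False"
| "basic (Jmp _) = False"
| "basic Halt = False"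
| "basic _ = True"

fun exec :: "instr \<Rightarrow> regs \<Rightarrow> regs" where
  "exec (Const r c) R = R(r := c)"
| "exec (Add r x z) R = R(r := R x + R z)"
| "exec (Sub r x z) R = R(r := R x - R z)"
| "exec (Load r x) R = R(r := R (R x))"
| "exec (Store r x) R = R(R r := R x)"
| "exec _ R = R"

fun clen :: "com \<Rightarrow> nat" where
  "clen (Blk is) = length is"
| "clen (c1 ;; c2) = clen c1 + clen c2"
| "clen (If0 r c1 c2) = clen c1 + clen c2 + 2"
| "clen (While r c) = clen c + 2"

text \<open>The second argument is the absolute address of the first instruction.\<close>

fun compile :: "com \<Rightarrow> nat \<Rightarrow> prog" where
  "compile (Blk is) p = is"
| "compile (c1 ;; c2) p = compile c1 p @ compile c2 (p + clen c1)"
| "compile (If0 r c1 c2) p =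
     Jle0 r (p + clen c2 + 2) # compile c2 (p + 1) @ Jmp (p + clen c1 + clen c2 + 2) #
     compile c1 (p + clen c2 + 2)"
| "compile (While r c) p = Jle0 r (p + clen c + 2) # compile c (p + 1) @ [Jmp p]"

lemma length_compile [simp]: "length (compile c p) = clen c"
  by (induction c arbitrary: p) auto

section \<open>Cost-counting big-step semantics and correctness of compilation\<close>

inductive runs :: "com \<Rightarrow> regs \<Rightarrow> nat \<Rightarrow> regs \<Rightarrow> bool" where
  Blk: "list_all basic is \<Longrightarrow> runs (Blk is) R (length is) (fold exec is R)"
| Seq: "runs c1 R t R' \<Longrightarrow> runs c2 R' t' R'' \<Longrightarrow> runs (c1 ;; c2) R (t + t') R''"
| IfLe: "R r \<le> 0 \<Longrightarrow> runs c1 R t R' \<Longrightarrow> runs (If0 r c1 c2) R (t + 1) R'"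
| IfGt: "R r > 0 \<Longrightarrow> runs c2 R t R' \<Longrightarrow> runs (If0 r c1 c2) R (t + 2) R'"
| WhileEnd: "R r \<le> 0 \<Longrightarrow> runs (While r c) R 1 R"
| WhileStep: "R r > 0 \<Longrightarrow> runs c R t R' \<Longrightarrow> runs (While r c) R' t' R'' \<Longrightarrow>
    runs (While r c) R (t + t' + 2) R''"

definition code_at :: "prog \<Rightarrow> nat \<Rightarrow> prog \<Rightarrow> bool" where
  "code_at P p is \<longleftrightarrow> (\<exists>pre post. P = pre @ is @ post \<and> length pre = p)"

lemma code_at_append:
  "code_at P p (xs @ ys) \<longleftrightarrow> code_at P p xs \<and> code_at P (p + length xs) ys"
proof
  assume "code_at P p (xs @ ys)"
  then obtain pre post where "P = pre @ (xs @ ys) @ post" "length pre = p"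
    by (auto simp: code_at_def)
  then have "P = pre @ xs @ (ys @ post)" "P = (pre @ xs) @ ys @ post" "length (pre @ xs) = p + length xs"
    by auto
  then show "code_at P p xs \<and> code_at P (p + length xs) ys"
    unfolding code_at_def using \<open>length pre = p\<close> by blast
next
  assume *: "code_at P p xs \<and> code_at P (p + length xs) ys"
  then obtain pre post pre' post' where eq: "P = pre @ xs @ post" "length pre = p"
      "P = pre' @ ys @ post'" "length pre' = p + length xs"
    unfolding code_at_def by blast
  have "take (p + length xs) P = pre @ xs" using eq(1,2) by simp
  moreover have "take (p + length xs) P = pre'" using eq(3,4) by simp
  ultimately have "P = pre @ (xs @ ys) @ post'" using eq(3) by simp
  then show "code_at P p (xs @ ys)" unfolding code_at_def using eq(2) by blast
qed

lemma code_at_Cons: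
  "code_at P p (i # is) \<longleftrightarrow> p < length P \<and> P ! p = i \<and> code_at P (p + 1) is"
proof -
  have "code_at P p [i] \<longleftrightarrow> p < length P \<and> P ! p = i"
    unfolding code_at_def
    by (metis append_Cons append_eq_conv_conj append_self_conv2 id_take_nth_drop length_append
        length_greater_0_conv less_add_same_cancel1 list.distinct(1) min.absorb4 length_take
        nth_append_length)
  then show ?thesis
    using code_at_append[of P p "[i]" "is"] by simp
qed

lemma step_basic:
  assumes "p < length P" "P ! p = i" "basic i"
  shows "step P (p, R) = (p + 1, exec i R)"
  using assms by (cases i) (auto simp: step_def halted_def)

lemma steps_basic:
  assumes "code_at P p is" "list_all basic is"
  shows "(step P ^^ length is) (p, R) = (p + length is, fold exec is R)"
  using assms
proof (induction "is" arbitrary: p R)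
  case (Cons i "is")
  then show ?case
    by (simp add: code_at_Cons step_basic funpow_Suc_right del: funpow.simps)
qed auto

lemma step_Jle0:
  assumes "p < length P" "P ! p = Jle0 r l"
  shows "step P (p, R) = (if R r \<le> 0 then (l, R) else (p + 1, R))"
  using assms by (auto simp: step_def halted_def)

lemma step_Jmp:
  assumes "p < length P" "P ! p = Jmp l"
  shows "step P (p, R) = (l, R)"
  using assms by (auto simp: step_def halted_def)

text \<open>Rule induction on the run. The absolute jump targets are right because the code was
  compiled for the very address \<open>p\<close> at which it lies in \<open>P\<close>; the induction
  hypotheses are applied to the subprograms at their shifted addresses.\<close>

lemma steps_compile:
  assumes "runs c R t R'" "code_at P p (compile c p)"
  shows "(step P ^^ t) (p, R) = (p + clen c, R')"
  using assms
proof (induction arbitrary: p rule: runs.induct)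
  case (Blk "is" R)
  then show ?case by (simp add: steps_basic)
next
  case (Seq c1 R t R' c2 t' R'')
  then have "(step P ^^ (t' + t)) (p, R) = (p + clen c1 + clen c2, R'')"
    by (auto simp: code_at_append funpow_add)
  then show ?case by (simp add: add_ac)
next
  case (IfLe R r c1 t R' c2)
  then have "code_at P (p + clen c2 + 2) (compile c1 (p + clen c2 + 2))"
    by (auto simp: code_at_append code_at_Cons add_ac)
  with IfLe show ?case
    by (auto simp: code_at_append code_at_Cons step_Jle0 funpow_swap1 add_ac)
next
  case (IfGt R r c2 t R' c1)
  \<comment> \<open>\<open>funpow_add\<close> applies the rightmost summand first: read from right
    to left, \<open>1 + (t + 1)\<close> is the conditional jump, the branch and the closing
    \<open>Jmp\<close>.\<close>
  then have "(step P ^^ (1 + (t + 1))) (p, R) = (p + clen c1 + clen c2 + 2, R')"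
    unfolding funpow_add
    by (auto simp: code_at_append code_at_Cons step_Jle0 step_Jmp add_ac)
  then show ?case by (simp add: add_ac)
next
  case (WhileEnd R r c)
  then show ?case by (auto simp: code_at_Cons step_Jle0)
next
  case (WhileStep R r c t R' t' R'')
  then have "code_at P p (compile (While r c) p)" by simp
  with WhileStep have "(step P ^^ (t' + (1 + (t + 1)))) (p, R) = (p + clen c + 2, R'')"
    unfolding funpow_add
    by (auto simp: code_at_append code_at_Cons step_Jle0 step_Jmp add_ac)
  then show ?case by (simp add: add_ac)
qed

text \<open>\<open>tb Z c\<close> bounds the running time provided that each loop, whenever entered, performs at most
\<open>Z\<close> iterations; the latter is a side condition of the loop rule below.\<close>

fun tb :: "nat \<Rightarrow> com \<Rightarrow> nat" where
  "tb Z (Blk is) = length is"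
| "tb Z (c1 ;; c2) = tb Z c1 + tb Z c2"
| "tb Z (If0 r c1 c2) = tb Z c1 + tb Z c2 + 2"
| "tb Z (While r c) = Z * (tb Z c + 2) + 1"

text \<open>Structural induction: composition and branching add degrees, a loop raises the degree by
  one. Hence \<open>C\<close> and \<open>d\<close> are fixed by the program text before
  \<open>Z\<close> is known.\<close>

lemma tb_polynomial: "\<exists>C d. \<forall>Z\<ge>1. tb Z c \<le> C * Z ^ d"
proof (induction c)
  case (Blk "is")
  then show ?case by (intro exI[of _ "length is"] exI[of _ 0]) simp
next
  \<comment> \<open>The summand 2 is for \<open>If0\<close>; the bound for \<open>Seq\<close> is
    weaker and follows.\<close>
  have *: "\<exists>C d. \<forall>Z\<ge>1. tb Z c1 + tb Z c2 + 2 \<le> C * Z ^ d"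
    if c1: "\<exists>C d. \<forall>Z\<ge>1. tb Z c1 \<le> C * Z ^ d" and c2: "\<exists>C d. \<forall>Z\<ge>1. tb Z c2 \<le> C * Z ^ d" for c1 c2
  proof -
    obtain C d C' d' where 1: "\<And>Z. Z \<ge> 1 \<Longrightarrow> tb Z c1 \<le> C * Z ^ d"
      and 2: "\<And>Z. Z \<ge> 1 \<Longrightarrow> tb Z c2 \<le> C' * Z ^ d'"
      using c1 c2 by blast
    have "tb Z c1 + tb Z c2 + 2 \<le> (C + C' + 2) * Z ^ (d + d')" if "Z \<ge> 1" for Z
    proof -
      have "C * Z ^ d \<le> C * Z ^ (d + d')" "C' * Z ^ d' \<le> C' * Z ^ (d + d')"
        using that by (intro mult_le_mono2 power_increasing; simp)+
      moreover have "2 \<le> 2 * Z ^ (d + d')" using that by simp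
      ultimately have "tb Z c1 + tb Z c2 + 2 \<le> C * Z ^ (d + d') + C' * Z ^ (d + d') + 2 * Z ^ (d + d')"
        using 1[OF that] 2[OF that] by linarith
      then show ?thesis by (simp only: distrib_right)
    qed
    then show ?thesis by blast
  qed
  case (Seq c1 c2)
  show ?case using *[OF Seq] by (metis add_leE tb.simps(2))
  case (If0 r c1 c2)
  show ?case using *[OF If0] by simp
next
  case (While r c)
  then obtain C d where 1: "\<And>Z. Z \<ge> 1 \<Longrightarrow> tb Z c \<le> C * Z ^ d" by blast
  have "tb Z (While r c) \<le> (C + 3) * Z ^ (d + 1)" if "Z \<ge> 1" for Z
  proof -
    have "Z * 1 \<le> Z * Z ^ d" using that by (intro mult_le_mono2) auto
    moreover have "Z * tb Z c \<le> Z * (C * Z ^ d)" using 1[OF that] by (rule mult_le_mono2)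
    ultimately have "Z * tb Z c + 2 * Z + 1 \<le> Z * (C * Z ^ d) + 3 * (Z * Z ^ d)" using that by linarith
    then show ?thesis by (simp add: algebra_simps)
  qed
  then show ?case by blast
qed

section \<open>Weakest preconditions that carry the time bound\<close>

definition wp :: "nat \<Rightarrow> com \<Rightarrow> (regs \<Rightarrow> bool) \<Rightarrow> regs \<Rightarrow> bool" where
  "wp Z c Q R \<longleftrightarrow> (\<exists>t R'. runs c R t R' \<and> t \<le> tb Z c \<and> Q R')"

lemma wp_Blk: "list_all basic is \<Longrightarrow> Q (fold exec is R) \<Longrightarrow> wp Z (Blk is) Q R"
  unfolding wp_def by (fastforce intro: runs.Blk)

lemma wp_Seq: "wp Z c1 (wp Z c2 Q) R \<Longrightarrow> wp Z (c1 ;; c2) Q R"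
  unfolding wp_def by (fastforce intro: runs.Seq add_mono)

lemma wp_If0:
  assumes "R r \<le> 0 \<Longrightarrow> wp Z c1 Q R" "R r > 0 \<Longrightarrow> wp Z c2 Q R"
  shows "wp Z (If0 r c1 c2) Q R"
proof (cases "R r \<le> 0")
  case True
  with assms(1) show ?thesis unfolding wp_def by (fastforce dest: IfLe)
next
  case False
  with assms(2) obtain t R' where "runs c2 R t R'" "t \<le> tb Z c2" "Q R'" unfolding wp_def by auto
  with False show ?thesis unfolding wp_def by (intro exI[of _ "t + 2"] exI[of _ R']) (use runs.IfGt in fastforce)
qed

lemma wp_mono: "wp Z c Q R \<Longrightarrow> (\<And>R'. Q R' \<Longrightarrow> Q' R') \<Longrightarrow> wp Z c Q' R"
  unfolding wp_def by blast

text \<open>The measure drops strictly in each iteration and is at most \<open>Z\<close> on entry,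
  so there are at most \<open>Z\<close> iterations, each costing the body plus two jumps; the final
  failing test costs one more step.\<close>

lemma wp_While:
  fixes \<mu> :: "regs \<Rightarrow> nat"
  assumes body: "\<And>R. I R \<Longrightarrow> R r > 0 \<Longrightarrow> wp Z c (\<lambda>R'. I R' \<and> \<mu> R' < \<mu> R) R"
    and "I R" "\<mu> R \<le> Z"
    and post: "\<And>R. I R \<Longrightarrow> R r \<le> 0 \<Longrightarrow> Q R"
  shows "wp Z (While r c) Q R"
proof -
  \<comment> \<open>With the current measure in place of \<open>Z\<close> the bound becomes
    inductive.\<close>
  have "\<exists>t R'. runs (While r c) R t R' \<and> t \<le> \<mu> R * (tb Z c + 2) + 1 \<and> Q R'"
    using \<open>I R\<close>
  proof (induction "\<mu> R" arbitrary: R rule: less_induct)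
    case less
    show ?case
    proof (cases "R r \<le> 0")
      case True
      then show ?thesis using post[OF less.prems] by (fastforce intro: WhileEnd)
    next
      case False
      then obtain t R' where 1: "runs c R t R'" "t \<le> tb Z c" "I R'" "\<mu> R' < \<mu> R"
        using body[OF less.prems] unfolding wp_def by auto
      obtain t' R'' where 2: "runs (While r c) R' t' R''" "t' \<le> \<mu> R' * (tb Z c + 2) + 1" "Q R''"
        using less.hyps[OF 1(4,3)] by blast
      have "(\<mu> R' + 1) * (tb Z c + 2) \<le> \<mu> R * (tb Z c + 2)"
        using 1(4) by (intro mult_right_mono) auto
      then have "t + t' + 2 \<le> \<mu> R * (tb Z c + 2) + 1"
        using 1(2) 2(2) by (simp add: algebra_simps)
      with False 1(1) 2(1,3) show ?thesis by (meson WhileStep not_le)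
    qed
  qed
  moreover have "\<mu> R * (tb Z c + 2) + 1 \<le> tb Z (While r c)"
    using mult_le_mono1[OF \<open>\<mu> R \<le> Z\<close>, of "tb Z c + 2"] by simp
  ultimately show ?thesis unfolding wp_def by (meson le_trans)
qed

text \<open>The run ends with the program counter just past the code, which counts as
  halted.\<close>

lemma halts_within_compile:
  assumes "wp Z c Q R"
  obtains t R' where "halts_within (compile c 0) R t R'" "t \<le> tb Z c" "Q R'"
proof -
  obtain t R' where *: "runs c R t R'" "t \<le> tb Z c" "Q R'"
    using assms unfolding wp_def by blast
  have "code_at (compile c 0) 0 (compile c 0)" by (auto simp: code_at_def)
  then have "(step (compile c 0) ^^ t) (0, R) = (clen c, R')"
    using steps_compile[OF *(1)] by simp
  then have "halts_within (compile c 0) R t R'"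
    by (simp add: halts_within_def halted_def)
  with * that show thesis by blast
qed

section \<open>Subprograms\<close>

text \<open>The input occupies the registers \<open>0, \<dots>, n + 2\<close>, the digits of the current word \<open>n + 3, \<dots>, 3 n + 3\<close>,
and the table of surviving words starts at \<open>3 n + 4\<close>. Variables have negative addresses: \<open>-1\<close> and \<open>-6\<close>
hold the constants \<open>1\<close> and \<open>0\<close>, \<open>-2\<close> the base \<open>b\<close>, \<open>-3\<close> and \<open>-4\<close> the numbers
\<open>K = b ^ (2 n)\<close> and \<open>N = b ^ (2 n + 1)\<close>, \<open>-5\<close> the address of the table; addresses up to \<open>-20\<close> are scratch.\<close>

definition loop :: "int \<Rightarrow> com \<Rightarrow> com" where
  "loop c body = While c (body ;; Blk [Sub c c (-1)])"

text \<open>The counter itself serves as the measure of \<open>wp_While\<close>. The invariant for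
  \<open>Suc j\<close> is demanded of the updated state because the counter is decremented only
  after the body.\<close>

lemma wp_loop:
  assumes "R c = int k" "k \<le> Z" "R (-1) = 1" "I 0 R"
    and body: "\<And>j R. j < k \<Longrightarrow> I j R \<Longrightarrow> R c = int k - int j \<Longrightarrow> R (-1) = 1 \<Longrightarrow>
      wp Z body (\<lambda>R'. R' c = int k - int j \<and> R' (-1) = 1 \<and> I (Suc j) (R'(c := int k - int (Suc j)))) R"
    and post: "\<And>R. I k R \<Longrightarrow> R (-1) = 1 \<Longrightarrow> Q R"
    and "c \<noteq> -1"
  shows "wp Z (loop c body) Q R"
  unfolding loop_def
proof (rule wp_While[where I = "\<lambda>R. \<exists>j\<le>k. I j R \<and> R c = int k - int j \<and> R (-1) = 1" and \<mu> = "\<lambda>R. nat (R c)"])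
  show "\<exists>j\<le>k. I j R \<and> R c = int k - int j \<and> R (-1) = 1" using assms(1,3,4) by auto
  show "nat (R c) \<le> Z" using assms(1,2) by simp
next
  fix R assume "\<exists>j\<le>k. I j R \<and> R c = int k - int j \<and> R (-1) = 1" "R c > 0"
  then obtain j where "j < k" and j: "I j R" "R c = int k - int j" "R (-1) = 1" by auto
  note b = body[OF this]
  show "wp Z (body ;; Blk [Sub c c (-1)])
      (\<lambda>R'. (\<exists>j\<le>k. I j R' \<and> R' c = int k - int j \<and> R' (-1) = 1) \<and> nat (R' c) < nat (R c)) R"
  proof (rule wp_Seq, rule wp_mono[OF b], rule wp_Blk)
    fix R' assume R': "R' c = int k - int j \<and> R' (-1) = 1 \<and> I (Suc j) (R'(c := int k - int (Suc j)))"
    have "int k - int (Suc j) = R' c - 1" using R' by simp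
    then have "I (Suc j) (R'(c := R' c - 1))" using R' by metis
    then show "(\<exists>j\<le>k. I j (fold exec [Sub c c (-1)] R') \<and> fold exec [Sub c c (-1)] R' c = int k - int j \<and>
      fold exec [Sub c c (-1)] R' (-1) = 1) \<and> nat (fold exec [Sub c c (-1)] R' c) < nat (R c)"
      using R' \<open>j < k\<close> j \<open>c \<noteq> -1\<close> by (auto intro!: exI[of _ "Suc j"])
  qed simp
next
  fix R assume "\<exists>j\<le>k. I j R \<and> R c = int k - int j \<and> R (-1) = 1" "R c \<le> 0"
  then show "Q R" using post by (metis diff_ge_0_iff_ge le_antisym of_nat_le_iff diff_le_0_iff_le)
qed

definition agree :: "int set \<Rightarrow> regs \<Rightarrow> regs \<Rightarrow> bool" where
  "agree S R R' \<longleftrightarrow> (\<forall>r. r \<notin> S \<longrightarrow> R' r = R r)"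

lemma agree_refl [simp]: "agree S R R" by (simp add: agree_def)

lemma agree_upd [simp]: "r \<in> S \<Longrightarrow> agree S R R' \<Longrightarrow> agree S R (R'(r := v))"
  by (auto simp: agree_def)

lemma agreeD: "agree S R R' \<Longrightarrow> r \<notin> S \<Longrightarrow> R' r = R r"
  by (simp add: agree_def)

section \<open>Sums and erasures along arithmetic progressions of addresses\<close>

definition sum_prog :: com where
  "sum_prog =
     Blk [Const (-22) 0, Add (-23) (-2) (-6)] ;;
     loop (-23) (Blk [Load (-24) (-20), Add (-22) (-22) (-24), Add (-20) (-20) (-21)])"

text \<open>All registers changed by the loop are negative while the addresses read are nonnegative,
  so each load still sees the initial content.\<close>

lemma wp_sum_prog:
  assumes "R (-1) = 1" "R (-6) = 0" "R (-2) = int b" "b \<le> Z"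
    and nn: "\<And>j. j < b \<Longrightarrow> R (-20) + int j * R (-21) \<ge> 0"
  shows "wp Z sum_prog (\<lambda>R'. agree {-20, -22, -23, -24} R R' \<and>
      R' (-22) = (\<Sum>j<b. R (R (-20) + int j * R (-21)))) R"
  unfolding sum_prog_def
proof (rule wp_Seq, rule wp_Blk, simp,
    rule wp_loop[where k = b and I = "\<lambda>j R'. agree {-20, -22, -23, -24} R R' \<and>
       R' (-20) = R (-20) + int j * R (-21) \<and> R' (-22) = (\<Sum>j<j. R (R (-20) + int j * R (-21)))"])
  fix j R'
  assume "j < b" and I: "agree {-20, -22, -23, -24} R R' \<and>
       R' (-20) = R (-20) + int j * R (-21) \<and> R' (-22) = (\<Sum>j<j. R (R (-20) + int j * R (-21)))"
    "R' (-23) = int b - int j" "R' (-1) = 1"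
  then show "wp Z (Blk [Load (-24) (-20), Add (-22) (-22) (-24), Add (-20) (-20) (-21)])
     (\<lambda>R'. R' (-23) = int b - int j \<and> R' (-1) = 1 \<and> agree {-20, -22, -23, -24} R (R'(-23 := int b - int (Suc j))) \<and>
       (R'(-23 := int b - int (Suc j))) (-20) = R (-20) + int (Suc j) * R (-21) \<and>
       (R'(-23 := int b - int (Suc j))) (-22) = (\<Sum>j<Suc j. R (R (-20) + int j * R (-21)))) R'"
    using nn[OF \<open>j < b\<close>]
    by (intro wp_Blk) (auto simp: algebra_simps agreeD[of _ R R'])
qed (use assms in \<open>auto\<close>)

definition kill_prog :: com where
  "kill_prog =
     Blk [Add (-23) (-2) (-6)] ;;
     loop (-23) (Blk [Store (-20) (-6), Add (-20) (-20) (-21)])"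

lemma wp_kill_prog:
  assumes "R (-1) = 1" "R (-6) = 0" "R (-2) = int b" "b \<le> Z"
    and nn: "\<And>j. j < b \<Longrightarrow> R (-20) + int j * R (-21) \<ge> 0"
  shows "wp Z kill_prog (\<lambda>R'. \<forall>r. r \<notin> {-20, -23} \<longrightarrow>
      R' r = (if \<exists>j<b. r = R (-20) + int j * R (-21) then 0 else R r)) R"
  unfolding kill_prog_def
proof (rule wp_Seq, rule wp_Blk, simp,
    rule wp_loop[where k = b and I = "\<lambda>k R'. R' (-20) = R (-20) + int k * R (-21) \<and> (\<forall>r. r \<notin> {-20, -23} \<longrightarrow>
      R' r = (if \<exists>j<k. r = R (-20) + int j * R (-21) then 0 else R r))"])
  fix k R'
  assume "k < b" and I: "R' (-20) = R (-20) + int k * R (-21) \<and> (\<forall>r. r \<notin> {-20, -23} \<longrightarrow>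
      R' r = (if \<exists>j<k. r = R (-20) + int j * R (-21) then 0 else R r))"
    "R' (-23) = int b - int k" "R' (-1) = 1"
  \<comment> \<open>The stores hit only nonnegative addresses, so the stride in \<open>-21\<close>
    and the zero in \<open>-6\<close> survive the earlier iterations.\<close>
  have neg: "R' r = R r" if "r < 0" "r \<notin> {-20, -23}" for r
    using I(1) nn \<open>k < b\<close> that by (smt (verit, ccfv_SIG) less_trans)
  show "wp Z (Blk [Store (-20) (-6), Add (-20) (-20) (-21)])
     (\<lambda>R'. R' (-23) = int b - int k \<and> R' (-1) = 1 \<and>
       (R'(-23 := int b - int (Suc k))) (-20) = R (-20) + int (Suc k) * R (-21) \<and> (\<forall>r. r \<notin> {-20, -23} \<longrightarrow>
      (R'(-23 := int b - int (Suc k))) r = (if \<exists>j<Suc k. r = R (-20) + int j * R (-21) then 0 else R r))) R'"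
    using nn[OF \<open>k < b\<close>] I assms neg[of "-6"] neg[of "-21"]
    by (intro wp_Blk) (auto simp: algebra_simps less_Suc_eq)
qed (use assms in \<open>auto\<close>)

section \<open>Testing and counting tight indices\<close>

definition tight_prog :: com where
  "tight_prog =
     Blk [Const (-33) 2, Add (-34) 0 (-1), Const (-32) 1] ;;
     loop (-34) (
       Blk [Load (-35) (-33), Load (-36) (-31), Add (-35) (-35) (-36), Sub (-35) (-30) (-35)] ;;
       If0 (-35) (Blk []) (Blk [Const (-32) 0]) ;;
       Blk [Add (-33) (-33) (-1), Add (-31) (-31) (-1)])"

lemma wp_tight_prog:
  assumes "R (-1) = 1" "R 0 = int n" "n < Z" "R (-31) \<ge> 0"
  shows "wp Z tight_prog (\<lambda>R'. agree {-31, -32, -33, -34, -35, -36} R R' \<and>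
      R' (-32) = of_bool (\<forall>l\<le>n. R (-30) \<le> R (2 + int l) + R (R (-31) + int l))) R"
  unfolding tight_prog_def
proof (rule wp_Seq, rule wp_Blk, simp,
    rule wp_loop[where k = "n + 1" and I = "\<lambda>k R'. agree {-31, -32, -33, -34, -35, -36} R R' \<and>
       R' (-31) = R (-31) + int k \<and> R' (-33) = 2 + int k \<and>
       R' (-32) = of_bool (\<forall>l<k. R (-30) \<le> R (2 + int l) + R (R (-31) + int l))"])
  fix k R'
  assume "k < n + 1" and I: "agree {-31, -32, -33, -34, -35, -36} R R' \<and>
       R' (-31) = R (-31) + int k \<and> R' (-33) = 2 + int k \<and>
       R' (-32) = of_bool (\<forall>l<k. R (-30) \<le> R (2 + int l) + R (R (-31) + int l))"
    "R' (-34) = int (n + 1) - int k" "R' (-1) = 1"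
  note ag = agreeD[OF I(1)[THEN conjunct1]]
  show "wp Z (Blk [Load (-35) (-33), Load (-36) (-31), Add (-35) (-35) (-36), Sub (-35) (-30) (-35)] ;;
       If0 (-35) (Blk []) (Blk [Const (-32) 0]) ;;
       Blk [Add (-33) (-33) (-1), Add (-31) (-31) (-1)])
     (\<lambda>R'. R' (-34) = int (n + 1) - int k \<and> R' (-1) = 1 \<and>
       agree {-31, -32, -33, -34, -35, -36} R (R'(-34 := int (n + 1) - int (Suc k))) \<and>
       (R'(-34 := int (n + 1) - int (Suc k))) (-31) = R (-31) + int (Suc k) \<and>
       (R'(-34 := int (n + 1) - int (Suc k))) (-33) = 2 + int (Suc k) \<and>
       (R'(-34 := int (n + 1) - int (Suc k))) (-32) =
         of_bool (\<forall>l<Suc k. R (-30) \<le> R (2 + int l) + R (R (-31) + int l))) R'"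
    using I assms(4)
    by (intro wp_Blk wp_Seq wp_If0) (auto simp: ag less_Suc_eq)
qed (use assms in \<open>auto simp: less_Suc_eq_le\<close>)

text \<open>One program serves both halves of the validity test. The pointers \<open>-40\<close>
  into \<open>a\<close>, \<open>-41\<close> to the tested digit and \<open>-42\<close> to the window
  advance by the strides in \<open>-43\<close>, \<open>-44\<close>, \<open>-45\<close>: strides 1,
  1, 0 run through the indices of one window, strides -1, 0, 1 through the windows containing one
  fixed digit.\<close>

definition count_prog :: com where
  "count_prog =
     Blk [Const (-46) 0, Add (-47) 0 (-1)] ;;
     loop (-47) (
       Blk [Load (-30) (-40), Load (-48) (-41), Add (-30) (-30) (-48), Add (-31) (-42) (-6)] ;;
       tight_prog ;;
       Blk [Add (-46) (-46) (-32), Add (-40) (-40) (-43), Add (-41) (-41) (-44), Add (-42) (-42) (-45)])"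

abbreviation count_regs :: "int set" where
  "count_regs \<equiv> {-30, -31, -32, -33, -34, -35, -36, -40, -41, -42, -46, -47, -48}"

lemma wp_count_prog:
  assumes R: "R (-1) = 1" "R (-6) = 0" "R 0 = int n" "n < Z"
    and nn: "\<And>j. j \<le> n \<Longrightarrow> R (-40) + int j * R (-43) \<ge> 0" "\<And>j. j \<le> n \<Longrightarrow> R (-41) + int j * R (-44) \<ge> 0"
      "\<And>j. j \<le> n \<Longrightarrow> R (-42) + int j * R (-45) \<ge> 0"
  defines "S \<equiv> \<lambda>k. \<Sum>j<k. of_bool (\<forall>l\<le>n. R (R (-40) + int j * R (-43)) + R (R (-41) + int j * R (-44))
        \<le> R (2 + int l) + R (R (-42) + int j * R (-45) + int l))"
  shows "wp Z count_prog (\<lambda>R'. agree count_regs R R' \<and> R' (-46) = S (n + 1)) R"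
  unfolding count_prog_def
proof (rule wp_Seq, rule wp_Blk, simp,
    rule wp_loop[where k = "n + 1" and I = "\<lambda>k R'. agree count_regs R R' \<and>
       R' (-40) = R (-40) + int k * R (-43) \<and> R' (-41) = R (-41) + int k * R (-44) \<and>
       R' (-42) = R (-42) + int k * R (-45) \<and> R' (-46) = S k"])
  fix k R'
  assume "k < n + 1" and I: "agree count_regs R R' \<and>
       R' (-40) = R (-40) + int k * R (-43) \<and> R' (-41) = R (-41) + int k * R (-44) \<and>
       R' (-42) = R (-42) + int k * R (-45) \<and> R' (-46) = S k"
    "R' (-47) = int (n + 1) - int k" "R' (-1) = 1"
  note ag = agreeD[OF I(1)[THEN conjunct1]]
  note nn' = nn[of k]
  have S_Suc: "S (Suc k) = S k + of_bool (\<forall>l\<le>n. R (R (-40) + int k * R (-43)) + R (R (-41) + int k * R (-44))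
        \<le> R (2 + int l) + R (R (-42) + int k * R (-45) + int l))"
    unfolding S_def by (rule sum.lessThan_Suc)
  show "wp Z (Blk [Load (-30) (-40), Load (-48) (-41), Add (-30) (-30) (-48), Add (-31) (-42) (-6)] ;;
       tight_prog ;;
       Blk [Add (-46) (-46) (-32), Add (-40) (-40) (-43), Add (-41) (-41) (-44), Add (-42) (-42) (-45)])
     (\<lambda>R'. R' (-47) = int (n + 1) - int k \<and> R' (-1) = 1 \<and>
       agree count_regs R (R'(-47 := int (n + 1) - int (Suc k))) \<and>
       (R'(-47 := int (n + 1) - int (Suc k))) (-40) = R (-40) + int (Suc k) * R (-43) \<and>
       (R'(-47 := int (n + 1) - int (Suc k))) (-41) = R (-41) + int (Suc k) * R (-44) \<and>
       (R'(-47 := int (n + 1) - int (Suc k))) (-42) = R (-42) + int (Suc k) * R (-45) \<and>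
       (R'(-47 := int (n + 1) - int (Suc k))) (-46) = S (Suc k)) R'"
    apply (rule wp_Seq, rule wp_Blk, simp, rule wp_Seq, rule wp_mono[OF wp_tight_prog[where n = n]])
    subgoal using I by simp
    subgoal using R by (simp add: ag)
    subgoal using R by simp
    subgoal using I nn' R \<open>k < n + 1\<close> by (simp add: ag)
    subgoal premises prems for R''
      apply (rule wp_Blk, simp)
      using prems I nn' R \<open>k < n + 1\<close>
      by (auto simp: ag agree_def S_Suc algebra_simps)
    done
qed (use assms in \<open>auto simp: less_Suc_eq_le\<close>)

lemma agree_mono: "agree S R R' \<Longrightarrow> S \<subseteq> T \<Longrightarrow> agree T R R'"
  by (auto simp: agree_def)

lemma agree_trans: "agree S R R' \<Longrightarrow> agree S R' R'' \<Longrightarrow> agree S R R''"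
  by (auto simp: agree_def)

section \<open>Division with remainder and the digits of a word\<close>

definition divmod_prog :: com where
  "divmod_prog =
     Blk [Const (-54) 0, Sub (-55) (-51) (-2), Add (-55) (-55) (-1)] ;;
     While (-55) (Blk [Sub (-51) (-51) (-2), Add (-54) (-54) (-1), Sub (-55) (-55) (-2)])"

text \<open>Repeated subtraction. A jump tests only a sign, so \<open>-55\<close> keeps
  \<open>s - b + 1\<close>, which is positive exactly when the current remainder \<open>s\<close> is
  at least \<open>b\<close>. The remainder is the measure; it starts at \<open>t\<close>, which is
  at most \<open>Z\<close>.\<close>

lemma wp_divmod_prog:
  assumes R: "R (-1) = 1" "R (-2) = int b" "R (-51) = int t" "t \<le> Z" "b > 0"
  shows "wp Z divmod_prog (\<lambda>R'. agree {-51, -54, -55} R R' \<and>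
     R' (-51) = int (t mod b) \<and> R' (-54) = int (t div b)) R"
  unfolding divmod_prog_def
proof (rule wp_Seq, rule wp_Blk, simp,
    rule wp_While[where \<mu> = "\<lambda>R. nat (R (-51))" and I = "\<lambda>R'. agree {-51, -54, -55} R R' \<and>
      R' (-55) = R' (-51) - int b + 1 \<and>
      (\<exists>s k. t = s + k * b \<and> R' (-51) = int s \<and> R' (-54) = int k)"])
  fix R'
  assume I: "agree {-51, -54, -55} R R' \<and> R' (-55) = R' (-51) - int b + 1 \<and>
      (\<exists>s k. t = s + k * b \<and> R' (-51) = int s \<and> R' (-54) = int k)" and pos: "R' (-55) > 0"
  then obtain s k where sk: "t = s + k * b" "R' (-51) = int s" "R' (-54) = int k" by blast
  then have "s \<ge> b" using I pos by simp
  then have "t = (s - b) + (k + 1) * b \<and> int s - int b = int (s - b) \<and> int k + 1 = int (k + 1)"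
    using sk by simp
  then have "\<exists>s' k'. t = s' + k' * b \<and> int s - int b = int s' \<and> int k + 1 = int k'" by blast
  then show "wp Z (Blk [Sub (-51) (-51) (-2), Add (-54) (-54) (-1), Sub (-55) (-55) (-2)])
    (\<lambda>R''. (agree {-51, -54, -55} R R'' \<and> R'' (-55) = R'' (-51) - int b + 1 \<and>
      (\<exists>s k. t = s + k * b \<and> R'' (-51) = int s \<and> R'' (-54) = int k)) \<and> nat (R'' (-51)) < nat (R' (-51))) R'"
    using I sk(2,3) R \<open>s \<ge> b\<close>
    by (intro wp_Blk) (auto simp: agreeD[of _ R R'])
next
  fix R'
  assume I: "agree {-51, -54, -55} R R' \<and> R' (-55) = R' (-51) - int b + 1 \<and>
      (\<exists>s k. t = s + k * b \<and> R' (-51) = int s \<and> R' (-54) = int k)" and "R' (-55) \<le> 0"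
  then show "agree {-51, -54, -55} R R' \<and> R' (-51) = int (t mod b) \<and> R' (-54) = int (t div b)"
    using R by auto
qed (use R in \<open>auto intro: exI[of _ t] exI[of _ 0]\<close>)

definition digit :: "nat \<Rightarrow> nat \<Rightarrow> nat \<Rightarrow> nat" where
  "digit b w i = w div b ^ i mod b"

definition decode_prog :: com where
  "decode_prog =
     Blk [Add (-51) (-50) (-6), Add (-52) 0 0, Add (-52) (-52) (-1), Const (-53) 3, Add (-53) (-53) 0] ;;
     loop (-52) (
       divmod_prog ;;
       Blk [Store (-53) (-51), Add (-53) (-53) (-1), Add (-51) (-54) (-6)])"

lemma wp_decode_prog:
  assumes R: "R (-1) = 1" "R (-6) = 0" "R 0 = int n" "R (-2) = int b" "R (-50) = int w" "w \<le> Z" "b > 0" "2 * n + 1 \<le> Z"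
  shows "wp Z decode_prog (\<lambda>R'. agree ({-55..-51} \<union> {int n + 3..3 * int n + 3}) R R' \<and>
     (\<forall>i\<le>2*n. R' (int n + 3 + int i) = int (digit b w i))) R"
  unfolding decode_prog_def
proof (rule wp_Seq, rule wp_Blk, simp,
    rule wp_loop[where k = "2 * n + 1" and I = "\<lambda>k R'. agree ({-55..-51} \<union> {int n + 3..3 * int n + 3}) R R' \<and>
     R' (-51) = int (w div b ^ k) \<and> R' (-53) = int n + 3 + int k \<and>
     (\<forall>i<k. R' (int n + 3 + int i) = int (digit b w i))"])
  fix k R'
  assume k: "k < 2 * n + 1" and I: "agree ({-55..-51} \<union> {int n + 3..3 * int n + 3}) R R' \<and>
     R' (-51) = int (w div b ^ k) \<and> R' (-53) = int n + 3 + int k \<and>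
     (\<forall>i<k. R' (int n + 3 + int i) = int (digit b w i))"
    "R' (-52) = int (2 * n + 1) - int k" "R' (-1) = 1"
  note ag = agreeD[OF I(1)[THEN conjunct1]]
  have le: "w div b ^ k \<le> Z" using \<open>w \<le> Z\<close> by (meson div_le_dividend le_trans)
  show "wp Z (divmod_prog ;; Blk [Store (-53) (-51), Add (-53) (-53) (-1), Add (-51) (-54) (-6)])
     (\<lambda>R'. R' (-52) = int (2 * n + 1) - int k \<and> R' (-1) = 1 \<and>
       agree ({-55..-51} \<union> {int n + 3..3 * int n + 3}) R (R'(-52 := int (2 * n + 1) - int (Suc k))) \<and>
       (R'(-52 := int (2 * n + 1) - int (Suc k))) (-51) = int (w div b ^ Suc k) \<and>
       (R'(-52 := int (2 * n + 1) - int (Suc k))) (-53) = int n + 3 + int (Suc k) \<and>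
       (\<forall>i<Suc k. (R'(-52 := int (2 * n + 1) - int (Suc k))) (int n + 3 + int i) = int (digit b w i))) R'"
    apply (rule wp_Seq, rule wp_mono[OF wp_divmod_prog[where b = b and t = "w div b ^ k"]])
    subgoal using I by simp
    subgoal using R by (simp add: ag)
    subgoal using I by simp
    subgoal by (rule le)
    subgoal by (rule \<open>b > 0\<close>)
    subgoal premises prems for R''
    proof -
      note ag'' = agreeD[OF prems[THEN conjunct1]]
      have eq: "w div b ^ k div b = w div b ^ Suc k" by (metis div_mult2_eq power_Suc2)
      have dg: "w div b ^ k mod b = digit b w k" by (simp add: digit_def)
      have "agree ({-55..-51} \<union> {int n + 3..3 * int n + 3}) R R''"
        using I prems by (auto simp: agree_def)
      moreover have "R'' (int n + 3 + int i) = int (digit b w i)" if "i < k" for i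
        using I ag'' that by simp
      moreover have "R'' (-6) = 0" using R ag'' ag by simp
      moreover have "R'' (-53) = int n + 3 + int k" "R'' (-52) = R' (-52)" "R'' (-1) = 1"
        using I ag'' by simp_all
      ultimately show ?thesis
        using I k prems eq dg
        by (intro wp_Blk) (auto simp: less_Suc_eq)
    qed
    done
qed (use R in \<open>auto simp: less_Suc_eq_le\<close>)

lemma wp_BlkI: "list_all basic is \<Longrightarrow> fold exec is R = R' \<Longrightarrow> Q R' \<Longrightarrow> wp Z (Blk is) Q R"
  using wp_Blk by blast

lemma agree_upd_left: "r \<in> S \<Longrightarrow> agree S (R(r := v)) R' \<longleftrightarrow> agree S R R'"
  by (auto simp: agree_def)

section \<open>Marking the valid words\<close>

text \<open>Length \<open>2 * n + 1\<close> makes the middle digit \<open>n\<close> visible together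
  with all \<open>n + 1\<close> windows that contain it. The first conjunct is the recurrence on the
  window at digit 0, the second is minimality at the middle digit; both are sums because that is
  what \<open>count_prog\<close> returns.\<close>

definition valid_word :: "nat \<Rightarrow> (nat \<Rightarrow> int) \<Rightarrow> nat \<Rightarrow> nat \<Rightarrow> bool" where
  "valid_word n a b w \<longleftrightarrow>
     (2::int) \<le> (\<Sum>i<n + 1. of_bool (\<forall>l\<le>n. a i + int (digit b w i) \<le> a l + int (digit b w l))) \<and>
     (1::int) \<le> (\<Sum>k<n + 1. of_bool (\<forall>l\<le>n. a (n - k) + int (digit b w n) \<le> a l + int (digit b w (k + l))))"

text \<open>\<open>-59\<close> holds the first count minus one, so that its sign tells whether there
  are at least two tight indices; the second count only has to be positive.\<close>

definition check_prog :: com where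
  "check_prog =
     decode_prog ;;
     Blk [Const (-40) 2, Const (-41) 3, Add (-41) (-41) 0, Add (-42) (-41) (-6),
       Const (-43) 1, Const (-44) 1, Const (-45) 0] ;;
     count_prog ;;
     Blk [Sub (-59) (-46) (-1), Const (-40) 2, Add (-40) (-40) 0, Const (-41) 3, Add (-41) (-41) 0,
       Add (-42) (-41) (-6), Add (-41) (-41) 0, Const (-43) (-1), Const (-44) 0, Const (-45) 1] ;;
     count_prog ;;
     Blk [Const (-58) 0] ;;
     If0 (-59) (Blk []) (If0 (-46) (Blk []) (Blk [Const (-58) 1]))"

definition mark_prog :: com where
  "mark_prog =
     Blk [Add (-57) (-4) (-6), Const (-50) 0, Add (-56) (-5) (-6)] ;;
     loop (-57) (
       check_prog ;;
       Blk [Store (-56) (-58), Add (-56) (-56) (-1), Add (-50) (-50) (-1)])"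

text \<open>\<open>b\<close> is one more than the oscillation bound \<open>M * (n + 1)\<close>, so
  integer solutions shifted to minimum 0 have their values below \<open>b\<close>. \<open>Z\<close>
  is chosen to majorise every loop count, among them the up to \<open>N + 1\<close> sweeps of the
  trimming.\<close>

locale params =
  fixes n :: nat and M :: int and a :: "nat \<Rightarrow> int" and b K N Z :: nat
  assumes b: "int b = 1 + (int n + 1) * M" and K: "K = b ^ (2 * n)" and N: "N = b ^ (2 * n + 1)"
    and Z: "Z = N + b + 2 * n + 2" and b_pos: "b > 0"
begin

lemma bounds: "b \<le> Z" "N < Z" "n + 1 \<le> Z" "2 * n + 1 \<le> Z" "K \<le> Z"
proof -
  have "K \<le> N" using b_pos by (auto simp: K N intro: power_increasing)
  then show "b \<le> Z" "N < Z" "n + 1 \<le> Z" "2 * n + 1 \<le> Z" "K \<le> Z" by (auto simp: Z)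
qed

definition core :: "regs \<Rightarrow> bool" where
  "core R \<longleftrightarrow> R 0 = int n \<and> (\<forall>i\<le>n. R (2 + int i) = a i) \<and> R (-1) = 1 \<and> R (-2) = int b \<and>
     R (-3) = int K \<and> R (-4) = int N \<and> R (-5) = 3 * int n + 4 \<and> R (-6) = 0"

text \<open>The registers that may be overwritten without disturbing \<open>core\<close>.\<close>

definition scratch :: "int set" where
  "scratch = {..-20} \<union> {int n + 3..}"

lemma core_agree: "core R \<Longrightarrow> agree S R R' \<Longrightarrow> S \<subseteq> scratch \<Longrightarrow> core R'"
  by (drule (1) agree_mono) (auto simp: core_def agree_def scratch_def)

definition check_regs :: "int set" where
  "check_regs = {-49..-30} \<union> {-55..-51} \<union> {-59,-58} \<union> {int n + 3..3 * int n + 3}"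

lemma check_regs_scratch: "check_regs \<subseteq> scratch"
  by (auto simp: check_regs_def scratch_def)

lemma wp_check_prog:
  assumes core: "core R" and w: "R (-50) = int w" "w < N"
  shows "wp Z check_prog (\<lambda>R'. agree check_regs R R' \<and> R' (-58) = of_bool (valid_word n a b w)) R"
  unfolding check_prog_def
  apply (rule wp_Seq, rule wp_mono[OF wp_decode_prog[where n = n and b = b and w = w]])
  using core w b_pos bounds apply (auto simp: core_def)[8]
  subgoal premises prems for R1
  proof -
    have ag: "agree check_regs R R1"
      by (rule agree_mono[OF prems[THEN conjunct1]]) (auto simp: check_regs_def)
    have dg: "R1 (int n + 3 + int i) = int (digit b w i)" if "i \<le> 2 * n" for i
      using prems that by blast
    have core1: "core R1" by (rule core_agree[OF core ag]) (rule check_regs_scratch)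
    show ?thesis
      apply (rule wp_Seq, rule wp_BlkI, simp, simp, rule wp_Seq, rule wp_mono[OF wp_count_prog[where n = n]])
      using core1 bounds apply (auto simp: core_def)[7]
      subgoal premises prems for R2
      proof -
        note agree_mono[OF prems[THEN conjunct1], of check_regs]
        then have ag2: "agree check_regs R1 R2"
          by (simp add: agree_upd_left check_regs_def)
        have core2: "core R2" by (rule core_agree[OF core1 ag2]) (rule check_regs_scratch)
        have dg2: "R2 (int n + 3 + int i) = int (digit b w i)" if "i \<le> 2 * n" for i
          using agreeD[OF prems[THEN conjunct1], of "int n + 3 + int i"] dg[OF that] by simp
        have c2: "R2 (-46) = (\<Sum>i<n + 1. of_bool (\<forall>l\<le>n. a i + int (digit b w i) \<le> a l + int (digit b w l)))"
          apply (subst prems[THEN conjunct2])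
          apply (rule sum.cong[OF refl])
          using core1 dg by (auto simp: core_def add_ac)
        show ?thesis
          apply (rule wp_Seq, rule wp_BlkI, simp, simp, rule wp_Seq, rule wp_mono[OF wp_count_prog[where n = n]])
          using core2 bounds apply (auto simp: core_def)[7]
          subgoal premises prems for R3
          proof -
            note agree_mono[OF prems[THEN conjunct1], of check_regs]
            then have ag3: "agree check_regs R2 R3"
              by (simp add: agree_upd_left check_regs_def)
            have 59: "R3 (-59) = R2 (-46) - 1" using agreeD[OF prems[THEN conjunct1], of "-59"] core2 by (simp add: core_def)
            have c3: "R3 (-46) = (\<Sum>k<n + 1. of_bool (\<forall>l\<le>n. a (n - k) + int (digit b w n) \<le> a l + int (digit b w (k + l))))"
              apply (subst prems[THEN conjunct2])
              apply (rule sum.cong[OF refl])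
              subgoal premises k for k
              proof -
                \<comment> \<open>With stride -1 the pointer into \<open>a\<close> moves down from
                  \<open>2 + n\<close>, so round \<open>k\<close> reads \<open>a (n - k)\<close>:
                  the middle digit has this index in the window starting at digit
                  \<open>k\<close>.\<close>
                have "2 + int n - int k = 2 + int (n - k)" using k by simp
                moreover have "R2 (2 + int (n - k)) = a (n - k)"
                  using core2 unfolding core_def by (meson diff_le_self)
                ultimately have "R2 (2 + int n - int k) = a (n - k)" by (simp only:)
                moreover have "R2 (3 + int n + int n) = int (digit b w n)" using dg2[of n] by (simp add: add_ac)
                moreover have "R2 (3 + int n + int k + int l) = int (digit b w (k + l))" if "l \<le> n" for l
                  using dg2[of "k + l"] k that by (simp add: add_ac)
                ultimately show ?thesis using core2 k by (auto simp: core_def)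
              qed
              done
            have "agree check_regs R R3" using ag ag2 ag3 by (blast intro: agree_trans)
            then show ?thesis
              unfolding valid_word_def c2[symmetric] c3[symmetric] using 59
              by (intro wp_Seq wp_Blk wp_If0) (auto simp: check_regs_def)
          qed
          done
      qed
      done
  qed
  done

definition addr :: "nat \<Rightarrow> int" where
  "addr w = 3 * int n + 4 + int w"

definition alive :: "regs \<Rightarrow> nat set" where
  "alive R = {w. w < N \<and> R (addr w) = 1}"

definition marked :: "regs \<Rightarrow> bool" where
  "marked R \<longleftrightarrow> (\<forall>w<N. R (addr w) \<in> {0, 1})"

lemma core_upd [simp]: "r \<in> scratch \<Longrightarrow> core R \<Longrightarrow> core (R(r := v))"
  by (auto simp: core_def scratch_def)

lemma wp_mark_prog:
  assumes core: "core R"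
  shows "wp Z mark_prog (\<lambda>R'. core R' \<and> marked R' \<and> alive R' = {w. w < N \<and> valid_word n a b w}) R"
  unfolding mark_prog_def
proof (rule wp_Seq, rule wp_Blk, simp,
    rule wp_loop[where k = N and I = "\<lambda>k R'. core R' \<and> R' (-50) = int k \<and> R' (-56) = addr k \<and>
      (\<forall>w<k. R' (addr w) = of_bool (valid_word n a b w))"])
  fix k R'
  assume "k < N" and I: "core R' \<and> R' (-50) = int k \<and> R' (-56) = addr k \<and>
      (\<forall>w<k. R' (addr w) = of_bool (valid_word n a b w))" "R' (-57) = int N - int k"
  show "wp Z (check_prog ;; Blk [Store (-56) (-58), Add (-56) (-56) (-1), Add (-50) (-50) (-1)])
     (\<lambda>R'. R' (-57) = int N - int k \<and> R' (-1) = 1 \<and> core (R'(-57 := int N - int (Suc k))) \<and>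
       (R'(-57 := int N - int (Suc k))) (-50) = int (Suc k) \<and>
       (R'(-57 := int N - int (Suc k))) (-56) = addr (Suc k) \<and>
       (\<forall>w<Suc k. (R'(-57 := int N - int (Suc k))) (addr w) = of_bool (valid_word n a b w))) R'"
    apply (rule wp_Seq, rule wp_mono[OF wp_check_prog[where w = k]])
    using I \<open>k < N\<close> apply auto[3]
    subgoal premises prems for R''
    proof -
      have core'': "core R''"
        using I prems core_agree[of R' check_regs R''] check_regs_scratch by blast
      have "R'' r = R' r" if "r \<notin> check_regs" for r using prems that by (auto simp: agree_def)
      then have "R'' (-57) = int N - int k" "R'' (-56) = addr k" "R'' (-50) = int k"
         "\<forall>w<k. R'' (addr w) = of_bool (valid_word n a b w)"
        using I by (auto simp: check_regs_def addr_def)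
      then show ?thesis
        using prems core'' by (intro wp_Blk) (auto simp: core_def addr_def less_Suc_eq)
    qed
    done
qed (use core bounds in \<open>auto simp: core_def addr_def marked_def alive_def\<close>)

end

section \<open>Trimming the word graph\<close>

text \<open>A number \<open>x\<close> below \<open>K\<close> encodes a word of length
  \<open>2 * n\<close>. The words ending in it occupy \<open>b\<close> consecutive addresses from
  \<open>addr (x * b)\<close> on, the words beginning with it lie at distance \<open>K\<close> from
  \<open>addr x\<close> on. If exactly one of the two groups has no survivor, the other is erased
  and the flag \<open>-60\<close> is raised.\<close>

definition sweep_prog :: com where
  "sweep_prog =
     Blk [Const (-60) 0, Add (-61) (-3) (-6), Add (-62) (-5) (-6), Add (-63) (-5) (-6)] ;;
     loop (-61) (
       Blk [Add (-20) (-63) (-6), Add (-21) (-1) (-6)] ;;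
       sum_prog ;;
       Blk [Add (-64) (-22) (-6), Add (-20) (-62) (-6), Add (-21) (-3) (-6)] ;;
       sum_prog ;;
       If0 (-64)
         (If0 (-22) (Blk [])
           (Blk [Const (-60) 1, Add (-20) (-62) (-6), Add (-21) (-3) (-6)] ;; kill_prog))
         (If0 (-22)
           (Blk [Const (-60) 1, Add (-20) (-63) (-6), Add (-21) (-1) (-6)] ;; kill_prog)
           (Blk [])) ;;
       Blk [Add (-62) (-62) (-1), Add (-63) (-63) (-2)])"

definition trim_prog :: com where
  "trim_prog = Blk [Const (-60) 1] ;; While (-60) sweep_prog"

context params
begin

definition arith_seq :: "nat \<Rightarrow> nat \<Rightarrow> nat set" where
  "arith_seq p s = (\<lambda>j. p + j * s) ` {..<b}"

text \<open>In a marked table every entry is 0 or 1, so the computed sum is a cardinality.\<close>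

lemma wp_sum_alive:
  assumes "core R" "marked R" "R (-20) = addr p" "R (-21) = int s" "arith_seq p s \<subseteq> {..<N}"
  shows "wp Z sum_prog (\<lambda>R'. agree {-20, -22, -23, -24} R R' \<and>
     R' (-22) = int (card {j. j < b \<and> p + j * s \<in> alive R})) R"
proof -
  have "(\<Sum>j<b. R (R (-20) + int j * R (-21))) = (\<Sum>j<b. of_bool (p + j * s \<in> alive R))"
  proof (rule sum.cong[OF refl])
    fix j assume "j \<in> {..<b}"
    then have "p + j * s < N" using assms(5) by (auto simp: arith_seq_def)
    moreover have "R (-20) + int j * R (-21) = addr (p + j * s)" using assms by (simp add: addr_def)
    ultimately show "R (R (-20) + int j * R (-21)) = of_bool (p + j * s \<in> alive R)"
      using assms(2) by (auto simp: marked_def alive_def)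
  qed
  also have "\<dots> = int (card {j. j < b \<and> p + j * s \<in> alive R})"
    by (simp add: Collect_conj_eq lessThan_def)
  finally have eq: "(\<Sum>j<b. R (R (-20) + int j * R (-21))) = int (card {j. j < b \<and> p + j * s \<in> alive R})" .
  show ?thesis
    unfolding eq[symmetric]
    using assms bounds by (intro wp_sum_prog) (auto simp: core_def addr_def)
qed

lemma wp_kill_alive:
  assumes "core R" "marked R" "R (-20) = addr p" "R (-21) = int s" "arith_seq p s \<subseteq> {..<N}"
  shows "wp Z kill_prog (\<lambda>R'. core R' \<and> marked R' \<and> alive R' = alive R - arith_seq p s \<and>
     (\<forall>r<0. r \<notin> {-20, -23} \<longrightarrow> R' r = R r)) R"
proof (rule wp_mono[OF wp_kill_prog[where b = b]])
  fix R' assume R': "\<forall>r. r \<notin> {-20, -23} \<longrightarrow>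
      R' r = (if \<exists>j<b. r = R (-20) + int j * R (-21) then 0 else R r)"
  have addr_eq: "(\<exists>j<b. addr w = R (-20) + int j * R (-21)) \<longleftrightarrow> w \<in> arith_seq p s" for w
  proof -
    have "addr w = R (-20) + int j * R (-21) \<longleftrightarrow> w = p + j * s" for j
      using assms by (simp add: addr_def flip: of_nat_mult of_nat_add)
    then show ?thesis by (auto simp: arith_seq_def)
  qed
  have mem: "R' (addr w) = (if w \<in> arith_seq p s then 0 else R (addr w))" for w
    using R' addr_eq[of w] by (simp add: addr_def)
  have low: "R' r = R r" if "r < 3 * int n + 4" "r \<notin> {-20, -23}" for r
  proof -
    have "R (-20) + int j * R (-21) \<ge> 3 * int n + 4" for j using assms by (simp add: addr_def)
    then have "\<not> (\<exists>j<b. r = R (-20) + int j * R (-21))" using that by (metis not_le)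
    moreover have "R' r = (if \<exists>j<b. r = R (-20) + int j * R (-21) then 0 else R r)" using R' that(2) by blast
    ultimately show ?thesis by (simp only: if_False)
  qed
  have "core R'" using \<open>core R\<close> low by (auto simp: core_def)
  moreover have "marked R'" using \<open>marked R\<close> mem by (auto simp: marked_def)
  moreover have "alive R' = alive R - arith_seq p s" using mem by (auto simp: alive_def)
  ultimately show "core R' \<and> marked R' \<and> alive R' = alive R - arith_seq p s \<and>
     (\<forall>r<0. r \<notin> {-20, -23} \<longrightarrow> R' r = R r)"
    using low by auto
qed (use assms bounds in \<open>auto simp: core_def addr_def\<close>)

text \<open>Absence of dead ends, phrased by overlaps as the sweep tests it; the phrasing by
  successors and predecessors is \<open>balanced_iff\<close>.\<close>

definition balanced :: "nat set \<Rightarrow> bool" where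
  "balanced A \<longleftrightarrow> (\<forall>x<K. arith_seq (x * b) 1 \<inter> A = {} \<longleftrightarrow> arith_seq x K \<inter> A = {})"

lemma arith_seq_less:
  assumes "x < K"
  shows "arith_seq (x * b) 1 \<subseteq> {..<N}" "arith_seq x K \<subseteq> {..<N}"
proof -
  have N': "N = K * b" by (simp add: N K)
  have "x * b + j < N" if "j < b" for j
  proof -
    have "x * b + j < (x + 1) * b" using that by simp
    also have "\<dots> \<le> K * b" using assms by (intro mult_le_mono1) simp
    finally show ?thesis by (simp add: N')
  qed
  moreover have "x + j * K < N" if "j < b" for j
  proof -
    have "x + j * K < (j + 1) * K" using assms by simp
    also have "\<dots> \<le> b * K" using that by (intro mult_le_mono1) simp
    finally show ?thesis by (simp add: N' mult.commute)
  qed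
  ultimately show "arith_seq (x * b) 1 \<subseteq> {..<N}" "arith_seq x K \<subseteq> {..<N}"
    by (auto simp: arith_seq_def)
qed

lemma card_alive_le_0:
  "int (card {j. j < b \<and> p + j * s \<in> A}) \<le> 0 \<longleftrightarrow> arith_seq p s \<inter> A = {}"
proof -
  have "finite {j. j < b \<and> p + j * s \<in> A}" by simp
  then have "card {j. j < b \<and> p + j * s \<in> A} = 0 \<longleftrightarrow> {j. j < b \<and> p + j * s \<in> A} = {}" by simp
  then show ?thesis by (auto simp: arith_seq_def)
qed

lemma marked_agree:
  assumes "agree S R R'" "S \<subseteq> {..<0}"
  shows "marked R' = marked R" "alive R' = alive R"
proof -
  have "R' (addr w) = R (addr w)" for w
    using assms by (intro agreeD) (auto simp: addr_def)
  then show "marked R' = marked R" "alive R' = alive R" by (auto simp: marked_def alive_def)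
qed

text \<open>In the unbalanced case exactly one of the two progressions meets \<open>A\<close>, so
  subtracting both erases just the group without a partner.\<close>

definition sweep_step :: "nat \<Rightarrow> nat set \<Rightarrow> nat set" where
  "sweep_step x A = (if arith_seq (x * b) 1 \<inter> A = {} \<longleftrightarrow> arith_seq x K \<inter> A = {} then A
     else A - arith_seq (x * b) 1 - arith_seq x K)"

lemma wp_sweep_body:
  assumes "core R" "marked R" "x < K" "R (-62) = addr x" "R (-63) = addr (x * b)"
  shows "wp Z (Blk [Add (-20) (-63) (-6), Add (-21) (-1) (-6)] ;;
       sum_prog ;;
       Blk [Add (-64) (-22) (-6), Add (-20) (-62) (-6), Add (-21) (-3) (-6)] ;;
       sum_prog ;;
       If0 (-64)
         (If0 (-22) (Blk [])
           (Blk [Const (-60) 1, Add (-20) (-62) (-6), Add (-21) (-3) (-6)] ;; kill_prog))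
         (If0 (-22)
           (Blk [Const (-60) 1, Add (-20) (-63) (-6), Add (-21) (-1) (-6)] ;; kill_prog)
           (Blk [])) ;;
       Blk [Add (-62) (-62) (-1), Add (-63) (-63) (-2)])
    (\<lambda>R'. core R' \<and> marked R' \<and> alive R' = sweep_step x (alive R) \<and>
       R' (-60) = (if alive R' = alive R then R (-60) else 1) \<and>
       R' (-61) = R (-61) \<and> R' (-62) = addr (Suc x) \<and> R' (-63) = addr (Suc x * b)) R"
    (is "wp Z _ ?Q R")
proof -
  let ?T = "{-20, -21, -22, -23, -24, -64} :: int set"
  let ?in = "arith_seq (x * b) 1" and ?out = "arith_seq x K"
  note less = arith_seq_less[OF \<open>x < K\<close>]
  note c = \<open>core R\<close>[unfolded core_def]
  show ?thesis
    apply (rule wp_Seq, rule wp_BlkI, simp, simp, rule wp_Seq,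
        rule wp_mono[OF wp_sum_alive[where p = "x * b" and s = 1]])
    using assms c less apply (auto simp: scratch_def marked_def addr_def)[5]
    subgoal premises prems for R1
    proof -
      have "agree ?T (R(-20 := R (-63) + R (-6), -21 := R (-1) + R (-6))) R1"
        by (rule agree_mono[OF prems[THEN conjunct1]]) auto
      then have ag1: "agree ?T R R1" by (simp add: agree_upd_left)
      have "alive (R(-20 := R (-63) + R (-6), -21 := R (-1) + R (-6))) = alive R"
        by (auto simp: alive_def addr_def)
      then have s1: "R1 (-22) \<le> 0 \<longleftrightarrow> ?in \<inter> alive R = {}"
        using card_alive_le_0[of "x * b" 1 "alive R"] prems by simp
      have core1: "core R1" by (rule core_agree[OF \<open>core R\<close> ag1]) (auto simp: scratch_def)
      note c1 = core1[unfolded core_def]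
      have m1: "marked R1" "alive R1 = alive R" using marked_agree[OF ag1] \<open>marked R\<close> by auto
      show ?thesis
        apply (rule wp_Seq, rule wp_BlkI, simp, simp, rule wp_Seq,
            rule wp_mono[OF wp_sum_alive[where p = "x" and s = K]])
        using assms core1 c1 m1 less agreeD[OF ag1, of "-62"] apply (auto simp: scratch_def marked_def addr_def)[5]
        subgoal premises prems for R2
        proof -
          note agree_mono[OF prems[THEN conjunct1], of ?T]
          then have ag2: "agree ?T R1 R2" by (simp add: agree_upd_left)
          have ag: "agree ?T R R2" using ag1 ag2 by (rule agree_trans)
          have "alive (R1(-64 := R1 (-22) + R1 (-6), -20 := R1 (-62) + R1 (-6), -21 := R1 (-3) + R1 (-6))) = alive R"
            using m1 by (auto simp: alive_def addr_def)
          then have s2: "R2 (-22) \<le> 0 \<longleftrightarrow> ?out \<inter> alive R = {}"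
            using card_alive_le_0[of x K "alive R"] prems by simp
          have s1': "R2 (-64) \<le> 0 \<longleftrightarrow> ?in \<inter> alive R = {}"
            using agreeD[OF prems[THEN conjunct1], of "-64"] s1 c1 by simp
          have core2: "core R2" by (rule core_agree[OF \<open>core R\<close> ag]) (auto simp: scratch_def)
          note c2 = core2[unfolded core_def]
          have m2: "marked R2" "alive R2 = alive R" using marked_agree[OF ag] \<open>marked R\<close> by auto
          have regs2: "R2 (-60) = R (-60)" "R2 (-61) = R (-61)" "R2 (-62) = addr x" "R2 (-63) = addr (x * b)"
            using assms agreeD[OF ag] by auto
          \<comment> \<open>The pointer increments close all four branches and are verified once for
            all of them.\<close>
          have fin: "wp Z (Blk [Add (-62) (-62) (-1), Add (-63) (-63) (-2)]) ?Q R'"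
            if "core R'" "marked R'" "alive R' = sweep_step x (alive R)"
              "R' (-60) = (if alive R' = alive R then R (-60) else 1)"
              "R' (-61) = R (-61)" "R' (-62) = addr x" "R' (-63) = addr (x * b)" for R'
          proof (rule wp_BlkI, simp, rule refl)
            let ?R = "fold exec [Add (-62) (-62) (-1), Add (-63) (-63) (-2)] R'"
            have ag': "agree {-62, -63} R' ?R" by simp
            show "core ?R \<and> marked ?R \<and> alive ?R = sweep_step x (alive R) \<and>
               ?R (-60) = (if alive ?R = alive R then R (-60) else 1) \<and>
               ?R (-61) = R (-61) \<and> ?R (-62) = addr (Suc x) \<and> ?R (-63) = addr (Suc x * b)"
              using that marked_agree[OF ag'] core_agree[OF that(1) ag'] that(1)[unfolded core_def]
              by (auto simp: scratch_def addr_def algebra_simps)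
          qed
          have upd: "core (R2(-60 := 1, -20 := u, -21 := v))" "marked (R2(-60 := 1, -20 := u, -21 := v))"
            "alive (R2(-60 := 1, -20 := u, -21 := v)) = alive R" for u v
          proof -
            have "agree {-60, -20, -21} R2 (R2(-60 := 1, -20 := u, -21 := v))" by simp
            from core_agree[OF core2 this] marked_agree[OF this] m2
            show "core (R2(-60 := 1, -20 := u, -21 := v))" "marked (R2(-60 := 1, -20 := u, -21 := v))"
            "alive (R2(-60 := 1, -20 := u, -21 := v)) = alive R" by (auto simp: scratch_def)
          qed
          have kill: "wp Z kill_prog (\<lambda>R'. core R' \<and> marked R' \<and> alive R' = alive R - arith_seq p s \<and>
               (\<forall>r<0. r \<notin> {-20, -21, -23, -60} \<longrightarrow> R' r = R2 r) \<and> R' (-60) = 1) (R2(-60 := 1, -20 := addr p, -21 := int s))"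
            if "arith_seq p s \<subseteq> {..<N}" for p s
            by (rule wp_mono[OF wp_kill_alive[where p = p and s = s]]) (use upd that in auto)
          show ?thesis
          proof (rule wp_Seq, rule wp_If0; rule wp_If0)
            assume "R2 (-64) \<le> 0" "R2 (-22) \<le> 0"
            note signs = this
            show "wp Z (Blk []) (wp Z (Blk [Add (-62) (-62) (-1), Add (-63) (-63) (-2)]) ?Q) R2"
              apply (rule wp_BlkI, simp, simp)
              apply (rule fin)
              using signs s1' s2 core2 m2 regs2 by (auto simp: sweep_step_def)
          next
            assume "R2 (-64) > 0" "R2 (-22) > 0"
            note signs = this
            show "wp Z (Blk []) (wp Z (Blk [Add (-62) (-62) (-1), Add (-63) (-63) (-2)]) ?Q) R2"
              apply (rule wp_BlkI, simp, simp)
              apply (rule fin)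
              using signs s1' s2 core2 m2 regs2 by (auto simp: sweep_step_def)
          next
            assume "R2 (-64) \<le> 0" "R2 (-22) > 0"
            then have sw: "sweep_step x (alive R) = alive R - ?out" "sweep_step x (alive R) \<noteq> alive R"
              using s1' s2 by (auto simp: sweep_step_def)
            show "wp Z (Blk [Const (-60) 1, Add (-20) (-62) (-6), Add (-21) (-3) (-6)] ;; kill_prog)
              (wp Z (Blk [Add (-62) (-62) (-1), Add (-63) (-63) (-2)]) ?Q) R2"
              apply (rule wp_Seq, rule wp_BlkI, simp, simp add: c2 regs2)
              apply (rule wp_mono[OF kill[OF less(2)]])
              apply (rule fin)
              using sw regs2 by auto
          next
            assume "R2 (-64) > 0" "R2 (-22) \<le> 0"
            then have sw: "sweep_step x (alive R) = alive R - ?in" "sweep_step x (alive R) \<noteq> alive R"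
              using s1' s2 by (auto simp: sweep_step_def)
            show "wp Z (Blk [Const (-60) 1, Add (-20) (-63) (-6), Add (-21) (-1) (-6)] ;; kill_prog)
              (wp Z (Blk [Add (-62) (-62) (-1), Add (-63) (-63) (-2)]) ?Q) R2"
              apply (rule wp_Seq, rule wp_BlkI, simp, simp add: c2 regs2)
              apply (rule wp_mono[OF kill[OF less(1), unfolded of_nat_1]])
              apply (rule fin)
              using sw regs2 by auto
          qed
        qed
        done
    qed
    done
qed

lemma sweep_step_subset: "sweep_step x A \<subseteq> A"
  by (auto simp: sweep_step_def)

text \<open>If one group at \<open>x\<close> misses \<open>A\<close>, it misses \<open>G\<close>; by
  balance the other group misses \<open>G\<close> too, so erasing it does no harm to
  \<open>G\<close>.\<close>

lemma balanced_subset_sweep_step: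
  assumes "balanced G" "G \<subseteq> A" "x < K"
  shows "G \<subseteq> sweep_step x A"
  using assms unfolding sweep_step_def balanced_def by (auto split: if_splits)

text \<open>The live set only shrinks, so after one erasure it differs from the initial set for
  good. A flag still down at the end therefore certifies that no step changed anything, which is
  balance.\<close>

lemma wp_sweep_prog:
  assumes "core R" "marked R"
  shows "wp Z sweep_prog (\<lambda>R'. core R' \<and> marked R' \<and> alive R' \<subseteq> alive R \<and>
     (if R' (-60) \<le> 0 then alive R' = alive R \<and> balanced (alive R) else alive R' \<noteq> alive R) \<and>
     (\<forall>G. balanced G \<longrightarrow> G \<subseteq> alive R \<longrightarrow> G \<subseteq> alive R')) R"
  unfolding sweep_prog_def
proof (rule wp_Seq, rule wp_BlkI, simp, simp,
    rule wp_loop[where k = K and I = "\<lambda>k R'. core R' \<and> marked R' \<and> R' (-62) = addr k \<and>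
     R' (-63) = addr (k * b) \<and> alive R' \<subseteq> alive R \<and>
     (if R' (-60) \<le> 0 then alive R' = alive R \<and> (\<forall>x<k. sweep_step x (alive R) = alive R)
       else alive R' \<noteq> alive R) \<and>
     (\<forall>G. balanced G \<longrightarrow> G \<subseteq> alive R \<longrightarrow> G \<subseteq> alive R')"], goal_cases)
  case 1
  show ?case using assms by (simp add: core_def)
next
  case 2
  show ?case by (rule bounds)
next
  case 3
  show ?case using assms by (simp add: core_def)
next
  case 4
  let ?R = "R(-60 := 0, -61 := R (-3) + R (-6), -62 := R (-5) + R (-6), -63 := R (-5) + R (-6))"
  have "agree {-60, -61, -62, -63} R ?R" by simp
  from core_agree[OF \<open>core R\<close> this] marked_agree[OF this] assms
  show ?case by (auto simp: scratch_def addr_def core_def)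
next
  case (5 k R')
  then have R': "core R'" "marked R'" "R' (-62) = addr k" "R' (-63) = addr (k * b)" by auto
  show ?case
  proof (rule wp_mono[OF wp_sweep_body[OF R'(1,2) \<open>k < K\<close> R'(3,4)]])
    fix R''
    assume R'': "core R'' \<and> marked R'' \<and> alive R'' = sweep_step k (alive R') \<and>
       R'' (-60) = (if alive R'' = alive R' then R' (-60) else 1) \<and>
       R'' (-61) = R' (-61) \<and> R'' (-62) = addr (Suc k) \<and> R'' (-63) = addr (Suc k * b)"
    let ?R = "R''(-61 := int K - int (Suc k))"
    have "agree {-61} R'' ?R" by simp
    note core_agree[OF _ this] marked_agree[OF this]
    then have 1: "core ?R" "marked ?R" "alive ?R = sweep_step k (alive R')"
      using R'' by (auto simp: scratch_def)
    have 2: "\<forall>G. balanced G \<longrightarrow> G \<subseteq> alive R \<longrightarrow> G \<subseteq> alive ?R"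
      using 5 1(3) balanced_subset_sweep_step by metis
    show "R'' (-61) = int K - int k \<and> R'' (-1) = 1 \<and> core ?R \<and> marked ?R \<and> ?R (-62) = addr (Suc k) \<and>
      ?R (-63) = addr (Suc k * b) \<and> alive ?R \<subseteq> alive R \<and>
      (if ?R (-60) \<le> 0 then alive ?R = alive R \<and> (\<forall>x<Suc k. sweep_step x (alive R) = alive R)
       else alive ?R \<noteq> alive R) \<and>
     (\<forall>G. balanced G \<longrightarrow> G \<subseteq> alive R \<longrightarrow> G \<subseteq> alive ?R)"
    proof (intro conjI)
      show "alive ?R \<subseteq> alive R" using 1(3) sweep_step_subset[of k "alive R'"] 5 by auto
      show "if ?R (-60) \<le> 0 then alive ?R = alive R \<and> (\<forall>x<Suc k. sweep_step x (alive R) = alive R)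
       else alive ?R \<noteq> alive R"
        using 1(3) R'' 5(2) sweep_step_subset[of k "alive R'"] by (auto simp: less_Suc_eq split: if_splits)
    qed (use 1 2 R'' 5 in \<open>auto simp: core_def\<close>)
  qed
next
  case (6 R')
  have "balanced (alive R)" if "\<forall>x<K. sweep_step x (alive R) = alive R"
    unfolding balanced_def
  proof (intro allI impI, rule ccontr)
    fix x assume "x < K" and ne: "\<not> (arith_seq (x * b) 1 \<inter> alive R = {} \<longleftrightarrow> arith_seq x K \<inter> alive R = {})"
    have "sweep_step x (alive R) = alive R" using that \<open>x < K\<close> by blast
    then have "alive R - arith_seq (x * b) 1 - arith_seq x K = alive R"
      unfolding sweep_step_def using ne by (simp only: if_False)
    with ne show False by blast
  qed
  with 6 show ?case by (auto split: if_splits)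
qed simp

text \<open>The result is the largest balanced subset. A sweep that leaves the flag up has erased a
  word; the measure is the number of live words plus one, or zero when the flag is down, so the
  last, unproductive sweep decreases it as well.\<close>

lemma wp_trim_prog:
  assumes "core R" "marked R"
  shows "wp Z trim_prog (\<lambda>R'. core R' \<and> marked R' \<and> alive R' \<subseteq> alive R \<and> balanced (alive R') \<and>
     (\<forall>G. balanced G \<longrightarrow> G \<subseteq> alive R \<longrightarrow> G \<subseteq> alive R')) R"
  unfolding trim_prog_def
proof (rule wp_Seq, rule wp_BlkI, simp, simp,
    rule wp_While[where \<mu> = "\<lambda>R. if R (-60) > 0 then card (alive R) + 1 else 0" and
     I = "\<lambda>R'. core R' \<and> marked R' \<and> alive R' \<subseteq> alive R \<and> (R' (-60) \<le> 0 \<longrightarrow> balanced (alive R')) \<and>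
     (\<forall>G. balanced G \<longrightarrow> G \<subseteq> alive R \<longrightarrow> G \<subseteq> alive R')"], goal_cases)
  case (1 R')
  then have R': "core R'" "marked R'" by auto
  show ?case
  proof (rule wp_mono[OF wp_sweep_prog[OF R']])
    fix R''
    assume R'': "core R'' \<and> marked R'' \<and> alive R'' \<subseteq> alive R' \<and>
     (if R'' (-60) \<le> 0 then alive R'' = alive R' \<and> balanced (alive R') else alive R'' \<noteq> alive R') \<and>
     (\<forall>G. balanced G \<longrightarrow> G \<subseteq> alive R' \<longrightarrow> G \<subseteq> alive R'')"
    have "finite (alive R')" by (simp add: alive_def)
    then have "alive R'' \<noteq> alive R' \<Longrightarrow> card (alive R'') < card (alive R')"
      using R'' by (intro psubset_card_mono) auto
    then show "(core R'' \<and> marked R'' \<and> alive R'' \<subseteq> alive R \<and> (R'' (-60) \<le> 0 \<longrightarrow> balanced (alive R'')) \<and>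
     (\<forall>G. balanced G \<longrightarrow> G \<subseteq> alive R \<longrightarrow> G \<subseteq> alive R'')) \<and>
     (if R'' (-60) > 0 then card (alive R'') + 1 else 0) < (if R' (-60) > 0 then card (alive R') + 1 else 0)"
      using 1 R'' by (auto split: if_splits)
  qed
next
  case 2
  have "agree {-60} R (R(-60 := 1))" by simp
  from core_agree[OF \<open>core R\<close> this] marked_agree[OF this] assms
  show ?case by (auto simp: scratch_def)
next
  case 3
  have "card (alive (R(-60 := 1))) \<le> card {..<N}"
    by (rule card_mono) (auto simp: alive_def)
  then show ?case using Z by simp
next
  case 4
  then show ?case by auto
qed

end

section \<open>Branching test, initialisation and the whole program\<close>

definition branch_prog :: com where
  "branch_prog =
     Blk [Const (-65) 0, Add (-61) (-3) (-6), Add (-63) (-5) (-6)] ;;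
     loop (-61) (
       Blk [Add (-20) (-63) (-6), Add (-21) (-1) (-6)] ;;
       sum_prog ;;
       Blk [Sub (-22) (-22) (-1)] ;;
       If0 (-22) (Blk []) (Blk [Const (-65) 1]) ;;
       Blk [Add (-63) (-63) (-2)]) ;;
     Blk [Add 0 (-65) (-6)]"

text \<open>Products and powers by repeated addition. Each round of the second loop first saves the
  previous power in \<open>-3\<close>; it thus ends with \<open>b ^ (2 * n)\<close> there and
  \<open>b ^ (2 * n + 1)\<close> in \<open>-4\<close>.\<close>

definition init_prog :: com where
  "init_prog =
     Blk [Const (-1) 1, Const (-6) 0, Const (-2) 1, Add (-61) 0 (-1)] ;;
     loop (-61) (Blk [Add (-2) (-2) 1]) ;;
     Blk [Const (-4) 1, Add (-61) 0 0, Add (-61) (-61) (-1)] ;;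
     loop (-61) (
       Blk [Add (-3) (-4) (-6), Const (-4) 0, Add (-62) (-2) (-6)] ;;
       loop (-62) (Blk [Add (-4) (-4) (-3)])) ;;
     Blk [Add (-5) 0 0, Add (-5) (-5) 0, Const (-20) 4, Add (-5) (-5) (-20)]"

definition decision_prog :: com where
  "decision_prog = init_prog ;; mark_prog ;; trim_prog ;; branch_prog"

context params
begin

text \<open>The entries counted for \<open>x\<close> are the surviving words
  \<open>x * b + e\<close>, which differ only in their first digit and hence share their
  successors.\<close>

lemma wp_branch_prog:
  assumes "core R" "marked R"
  shows "wp Z branch_prog (\<lambda>R'. R' 0 = 1 \<longleftrightarrow> (\<exists>x<K. card {e. e < b \<and> x * b + e \<in> alive R} \<ge> 2)) R"
  unfolding branch_prog_def
proof (rule wp_Seq, rule wp_BlkI, simp, simp, rule wp_Seq,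
    rule wp_loop[where k = K and I = "\<lambda>k R'. agree {-20, -21, -22, -23, -24, -61, -63, -65} R R' \<and>
     R' (-63) = addr (k * b) \<and>
     R' (-65) = of_bool (\<exists>x<k. card {e. e < b \<and> x * b + e \<in> alive R} \<ge> 2)"], goal_cases)
  case 1
  show ?case using assms by (simp add: core_def)
next
  case 2
  show ?case by (rule bounds)
next
  case 3
  show ?case using assms by (simp add: core_def)
next
  case 4
  show ?case using assms by (simp add: core_def addr_def)
next
  case (5 k R')
  let ?S = "{-20, -21, -22, -23, -24, -61, -63, -65} :: int set"
  let ?c = "\<lambda>x. card {e. e < b \<and> x * b + e \<in> alive R}"
  from 5 have ag: "agree ?S R R'" by simp
  have core': "core R'" by (rule core_agree[OF assms(1) ag]) (auto simp: scratch_def)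
  note c' = core'[unfolded core_def]
  note m' = marked_agree[OF ag]
  show ?case
    apply (rule wp_Seq, rule wp_BlkI, simp, simp, rule wp_Seq,
        rule wp_mono[OF wp_sum_alive[where p = "k * b" and s = 1]])
    using 5 assms core' c' m' arith_seq_less[OF \<open>k < K\<close>] apply (auto simp: scratch_def marked_def addr_def)[5]
    subgoal premises prems for R''
    proof -
      let ?R = "R'(-20 := R' (-63) + R' (-6), -21 := R' (-1) + R' (-6))"
      have al: "alive ?R = alive R" using m' by (auto simp: alive_def addr_def)
      have cnt: "R'' (-22) = int (?c k)" using prems[THEN conjunct2] by (simp add: al)
      have "agree ?S ?R R''" by (rule agree_mono[OF prems[THEN conjunct1]]) auto
      then have "agree ?S R' R''" by (simp add: agree_upd_left)
      then have ag'': "agree ?S R R''" using ag agree_trans by blast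
      note keep = agreeD[OF prems[THEN conjunct1]]
      have regs: "R'' (-63) = addr (k * b)" "R'' (-65) = of_bool (\<exists>x<k. ?c x \<ge> 2)" "R'' (-61) = int K - int k"
        "R'' (-1) = 1" "R'' (-2) = int b"
        using 5 c' by (simp_all add: keep)
      have "addr (k * b) + int b = addr (Suc k * b)" by (simp add: addr_def)
      then show ?thesis
        using ag'' regs cnt
        by (intro wp_Seq wp_Blk wp_If0) (auto simp: less_Suc_eq)
    qed
    done
next
  case (6 R')
  then have "R' (-6) = R (-6)" by (intro agreeD[OF conjunct1]) auto
  then have "R' (-6) = 0" using assms(1) by (simp add: core_def)
  with 6 show ?case by (intro wp_Blk) auto
qed simp

lemma wp_init_prog:
  assumes "R 0 = int n" "R 1 = M" "\<forall>i\<le>n. R (2 + int i) = a i"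
  shows "wp Z init_prog core R"
  unfolding init_prog_def
proof (rule wp_Seq, rule wp_BlkI, simp, simp, rule wp_Seq,
    rule wp_loop[where k = "n + 1" and I = "\<lambda>k R'. agree {-1, -2, -6, -61} R R' \<and>
     R' (-6) = 0 \<and> R' (-2) = 1 + int k * M"], goal_cases)
  case 1
  show ?case using assms by simp
next
  case 2
  show ?case by (rule bounds)
next
  case 5
  then show ?case using assms by (intro wp_Blk) (auto simp: agreeD[of _ R] algebra_simps)
next
  case (6 R1)
  then have R1: "agree {-1, -2, -6, -61} R R1" "R1 (-6) = 0" "R1 (-2) = int b" "R1 (-1) = 1"
    by (auto simp: b)
  show ?case
  proof (rule wp_Seq, rule wp_BlkI, simp, simp, rule wp_Seq,
    rule wp_loop[where k = "2 * n + 1" and I = "\<lambda>k R'. agree {-1, -2, -3, -4, -6, -61, -62} R R' \<and>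
     R' (-6) = 0 \<and> R' (-2) = int b \<and> R' (-4) = int b ^ k \<and> (k > 0 \<longrightarrow> R' (-3) = int b ^ (k - 1))"], goal_cases)
    case 1
    show ?case using assms R1 by (simp add: agreeD[OF R1(1)])
  next
    case 2
    show ?case by (rule bounds)
  next
    case 3
    show ?case using R1 by simp
  next
    case 4
    show ?case using R1 agree_mono[OF R1(1)] by simp
  next
    case (5 k R2)
    show ?case
    proof (rule wp_Seq, rule wp_BlkI, simp, simp,
      rule wp_loop[where k = b and I = "\<lambda>j R'. agree {-1, -2, -3, -4, -6, -61, -62} R R' \<and>
       R' (-6) = 0 \<and> R' (-2) = int b \<and> R' (-61) = int (2 * n + 1) - int k \<and>
       R' (-4) = int j * int b ^ k \<and> R' (-3) = int b ^ k"], goal_cases)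
      case 2
      show ?case by (rule bounds)
    next
      case (5 j R3)
      then show ?case by (intro wp_Blk) (auto simp: algebra_simps)
    qed (use 5 in \<open>auto simp: algebra_simps\<close>)
  next
    case (6 R2)
    then have "R2 0 = int n" "\<forall>i\<le>n. R2 (2 + int i) = a i"
      using assms by (auto simp: agreeD[of _ R R2])
    moreover have "R2 (-4) = int N" "R2 (-3) = int K" using 6 by (auto simp: K N)
    ultimately show ?case using 6 by (intro wp_Blk) (auto simp: core_def)
  qed simp
qed (use assms in auto)

text \<open>A largest balanced set of valid words is unique, so it can be named by a description
  before the run and then identified with the set that the trimming leaves.\<close>

lemma wp_decision_prog:
  assumes "R 0 = int n" "R 1 = M" "\<forall>i\<le>n. R (2 + int i) = a i"
  obtains A where "A \<subseteq> {w. w < N \<and> valid_word n a b w}" "balanced A"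
    "\<And>G. balanced G \<Longrightarrow> G \<subseteq> {w. w < N \<and> valid_word n a b w} \<Longrightarrow> G \<subseteq> A"
    "wp Z decision_prog (\<lambda>R'. R' 0 = 1 \<longleftrightarrow> (\<exists>x<K. card {e. e < b \<and> x * b + e \<in> A} \<ge> 2)) R"
proof -
  let ?V = "{w. w < N \<and> valid_word n a b w}"
  define max_balanced where "max_balanced = (\<lambda>A. A \<subseteq> ?V \<and> balanced A \<and> (\<forall>G. balanced G \<longrightarrow> G \<subseteq> ?V \<longrightarrow> G \<subseteq> A))"
  define A where "A = (THE A. max_balanced A)"
  have unique: "A = A'" if "max_balanced A'" for A'
    unfolding A_def by (rule the_equality) (use that in \<open>unfold max_balanced_def, blast+\<close>)
  have "wp Z (trim_prog ;; branch_prog)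
      (\<lambda>R'. max_balanced A \<and> (R' 0 = 1 \<longleftrightarrow> (\<exists>x<K. card {e. e < b \<and> x * b + e \<in> A} \<ge> 2))) R1"
    if R1: "core R1" "marked R1" "alive R1 = ?V" for R1
  proof (rule wp_Seq, rule wp_mono[OF wp_trim_prog[OF R1(1,2)]])
    fix R2
    assume *: "core R2 \<and> marked R2 \<and> alive R2 \<subseteq> alive R1 \<and> balanced (alive R2) \<and>
     (\<forall>G. balanced G \<longrightarrow> G \<subseteq> alive R1 \<longrightarrow> G \<subseteq> alive R2)"
    then have "max_balanced (alive R2)" by (simp add: max_balanced_def R1)
    moreover from unique[OF this] have "A = alive R2" .
    ultimately show "wp Z branch_prog
      (\<lambda>R'. max_balanced A \<and> (R' 0 = 1 \<longleftrightarrow> (\<exists>x<K. card {e. e < b \<and> x * b + e \<in> A} \<ge> 2))) R2"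
      using wp_mono[OF wp_branch_prog[of R2]] * by simp
  qed
  then have wp: "wp Z decision_prog
      (\<lambda>R'. max_balanced A \<and> (R' 0 = 1 \<longleftrightarrow> (\<exists>x<K. card {e. e < b \<and> x * b + e \<in> A} \<ge> 2))) R"
    unfolding decision_prog_def
    by (intro wp_Seq[OF wp_mono[OF wp_init_prog[OF assms]]] wp_Seq[OF wp_mono[OF wp_mark_prog]]) auto
  \<comment> \<open>Existence of a largest balanced set is read off the terminating run.\<close>
  then have "max_balanced A" by (auto simp: wp_def)
  with wp_mono[OF wp] that[of A] show thesis by (simp add: max_balanced_def)
qed

end

section \<open>Boundedness and rounding of solutions\<close>

definition tight :: "nat \<Rightarrow> (nat \<Rightarrow> int) \<Rightarrow> (int \<Rightarrow> real) \<Rightarrow> int \<Rightarrow> nat \<Rightarrow> bool" where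
  "tight n a y k i \<longleftrightarrow> i \<le> n \<and>
     (\<forall>l\<le>n. real_of_int (a i) + y (int i + k) \<le> real_of_int (a l) + y (int l + k))"

lemma tight_iff:
  assumes "i \<le> n"
  shows "real_of_int (a i) + y (int i + k) = trop_min n a y k \<longleftrightarrow> tight n a y k i"
proof -
  have "real_of_int (a i) + y (int i + k) = trop_min n a y k \<longleftrightarrow>
    real_of_int (a i) + y (int i + k) \<le> trop_min n a y k"
    using assms unfolding trop_min_def by (auto intro!: antisym Min_le)
  also have "\<dots> \<longleftrightarrow> tight n a y k i"
    using assms by (auto simp: tight_def trop_min_def)
  finally show ?thesis .
qed

definition solution :: "nat \<Rightarrow> (nat \<Rightarrow> int) \<Rightarrow> (int \<Rightarrow> real) \<Rightarrow> bool" where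
  "solution n a y \<longleftrightarrow> satisfies n a y \<and> minimal_seq n a y"

text \<open>Minimality is stated at position \<open>k + n\<close>, which is index
  \<open>n - i\<close> of the window starting at \<open>k + i\<close>. Both conditions at
  \<open>k\<close> then involve only the positions from \<open>k\<close> to
  \<open>k + 2 * n\<close>, that is, one word.\<close>

lemma solution_iff:
  "solution n a y \<longleftrightarrow> (\<forall>k. (\<exists>i j. i \<noteq> j \<and> tight n a y k i \<and> tight n a y k j) \<and>
     (\<exists>i\<le>n. tight n a y (k + int i) (n - i)))"
proof -
  have "satisfies n a y \<longleftrightarrow> (\<forall>k. \<exists>i j. i \<noteq> j \<and> tight n a y k i \<and> tight n a y k j)"
  proof -
    have "(i \<le> n \<and> j \<le> n \<and> i \<noteq> j \<and> real_of_int (a i) + y (int i + k) = trop_min n a y k \<and>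
        real_of_int (a j) + y (int j + k) = trop_min n a y k) \<longleftrightarrow> i \<noteq> j \<and> tight n a y k i \<and> tight n a y k j" for i j k
      using tight_iff[of i n a y k] tight_iff[of j n a y k] tight_def[of n a y k i] tight_def[of n a y k j] by argo
    then show ?thesis unfolding satisfies_def by simp
  qed
  moreover have "(\<exists>k. j - int n \<le> k \<and> k \<le> j \<and> real_of_int (a (nat (j - k))) + y j = trop_min n a y k) \<longleftrightarrow>
      (\<exists>i\<le>n. tight n a y (j - int n + int i) (n - i))" for j
  proof
    assume "\<exists>k. j - int n \<le> k \<and> k \<le> j \<and> real_of_int (a (nat (j - k))) + y j = trop_min n a y k"
    then obtain k where k: "j - int n \<le> k" "k \<le> j" "real_of_int (a (nat (j - k))) + y j = trop_min n a y k"
      by blast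
    then have "tight n a y k (nat (j - k))"
      using tight_iff[of "nat (j - k)" n a y k] by simp
    moreover define i where "i = nat (k - j + int n)"
    then have "i \<le> n" "j - int n + int i = k" "n - i = nat (j - k)" using k by auto
    ultimately show "\<exists>i\<le>n. tight n a y (j - int n + int i) (n - i)" by metis
  next
    assume "\<exists>i\<le>n. tight n a y (j - int n + int i) (n - i)"
    then obtain i where i: "i \<le> n" "tight n a y (j - int n + int i) (n - i)" by blast
    have "int (n - i) + (j - int n + int i) = j" using i by simp
    then have "real_of_int (a (n - i)) + y j = trop_min n a y (j - int n + int i)"
      using tight_iff[of "n - i" n a y "j - int n + int i"] i by simp
    moreover have "nat (j - (j - int n + int i)) = n - i" by simp
    ultimately show "\<exists>k. j - int n \<le> k \<and> k \<le> j \<and> real_of_int (a (nat (j - k))) + y j = trop_min n a y k"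
      using i by (intro exI[of _ "j - int n + int i"]) auto
  qed
  then have "minimal_seq n a y \<longleftrightarrow> (\<forall>j. \<exists>i\<le>n. tight n a y (j - int n + int i) (n - i))"
    unfolding minimal_seq_def by simp
  moreover have "(\<forall>j. \<exists>i\<le>n. tight n a y (j - int n + int i) (n - i)) \<longleftrightarrow>
      (\<forall>k. \<exists>i\<le>n. tight n a y (k + int i) (n - i))"
    by (metis add_diff_cancel_right' diff_add_cancel)
  ultimately show ?thesis unfolding solution_def by blast
qed

text \<open>The coefficients are integers, so adding them commutes with the floor, and the floor is
  monotone.\<close>

lemma tight_floor:
  assumes "tight n a y k i"
  shows "tight n a (\<lambda>j. real_of_int \<lfloor>y j + t\<rfloor>) k i"
proof -
  have "a i + \<lfloor>y (int i + k) + t\<rfloor> \<le> a l + \<lfloor>y (int l + k) + t\<rfloor>" if "l \<le> n" for l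
  proof -
    have "\<lfloor>real_of_int (a i) + (y (int i + k) + t)\<rfloor> \<le> \<lfloor>real_of_int (a l) + (y (int l + k) + t)\<rfloor>"
      using assms that by (intro floor_mono) (auto simp: tight_def)
    then show ?thesis by simp
  qed
  then show ?thesis using assms by (auto simp: tight_def simp flip: of_int_add)
qed

lemma solution_floor: "solution n a y \<Longrightarrow> solution n a (\<lambda>j. real_of_int \<lfloor>y j + t\<rfloor>)"
  unfolding solution_iff using tight_floor by meson

lemma solution_add_const: "solution n a (\<lambda>j. y j + c) \<longleftrightarrow> solution n a y"
  by (simp add: solution_iff tight_def flip: add.assoc)

section \<open>Window minima and the oscillation of a solution\<close>

locale tropical =
  fixes n :: nat and M :: int and a :: "nat \<Rightarrow> int"
  assumes n: "n \<ge> 1" and M: "M \<ge> 0" and a: "\<And>i. i \<le> n \<Longrightarrow> 0 \<le> a i \<and> a i \<le> M" and a0: "a 0 = 0" and an: "a n = 0"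
begin

lemma solution_bounded:
  assumes "solution n a y"
  shows "y j - y j' \<le> real_of_int M * (real n + 1)"
proof -
  define m where "m = trop_min n a y"
  have m_le: "m k \<le> real_of_int (a i) + y (int i + k)" if "i \<le> n" for i k
    using that unfolding m_def trop_min_def by (intro Min_le) auto
  have m_eq: "m k = real_of_int (a i) + y (int i + k)" if "tight n a y k i" for i k
    using that tight_iff[of i n a y k] unfolding m_def tight_def by simp
  \<comment> \<open>Of two tight indices the larger is at least 1 and the smaller is below
    \<open>n\<close>; the former position also lies in the next window, the latter in the previous
    one.\<close>
  have two: "\<exists>i j. i < j \<and> j \<le> n \<and> tight n a y k i \<and> tight n a y k j" for k
  proof -
    obtain i j where "i \<noteq> j" "tight n a y k i" "tight n a y k j" using assms unfolding solution_iff by blast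
    moreover have "i \<le> n" "j \<le> n" using \<open>tight n a y k i\<close> \<open>tight n a y k j\<close> by (simp_all add: tight_def)
    ultimately show ?thesis by (meson linorder_neqE_nat)
  qed
  have abs_a: "real_of_int (a i) \<ge> 0" "real_of_int (a i) \<le> real_of_int M" if "i \<le> n" for i
    using a[OF that] by auto
  have up1: "m (k + 1) \<le> m k + real_of_int M" for k
  proof -
    obtain i' i where "i' < i" and i: "i \<le> n" "tight n a y k i" using two[of k] by blast
    then have "i \<ge> 1" by simp
    note i = this i
    have "m (k + 1) \<le> real_of_int (a (i - 1)) + y (int (i - 1) + (k + 1))" using i by (intro m_le) auto
    also have "int (i - 1) + (k + 1) = int i + k" using i by auto
    finally show ?thesis using m_eq[OF i(3)] abs_a(1)[OF i(2)] abs_a(2)[of "i - 1"] i by linarith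
  qed
  have down1: "m k \<le> m (k + 1) + real_of_int M" for k
  proof -
    obtain i where i: "i < n" "tight n a y (k + 1) i" using two[of "k + 1"] by (meson less_le_trans)
    have "m k \<le> real_of_int (a (i + 1)) + y (int (i + 1) + k)" using i by (intro m_le) auto
    also have "int (i + 1) + k = int i + (k + 1)" by simp
    finally show ?thesis using m_eq[OF i(2)] abs_a(1)[of i] abs_a(2)[of "i + 1"] i by linarith
  qed
  have up: "m (k + int t) \<le> m k + real t * real_of_int M" for k t
  proof (induction t)
    case (Suc t)
    have "m (k + int (Suc t)) \<le> m (k + int t) + real_of_int M" using up1[of "k + int t"] by (simp add: add_ac)
    with Suc show ?case by (simp add: algebra_simps)
  qed simp
  have down: "m (k - int t) \<le> m k + real t * real_of_int M" for k t
  proof (induction t)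
    case (Suc t)
    have "m (k - int (Suc t)) \<le> m (k - int t) + real_of_int M" using down1[of "k - int (Suc t)"] by (simp add: algebra_simps)
    with Suc show ?case by (simp add: algebra_simps)
  qed simp
  \<comment> \<open>The position of a tight \<open>i \<ge> 1\<close> is index 0 of the window at
    \<open>k + i\<close>, where its coefficient is \<open>a 0 = 0\<close>.\<close>
  have up_jump: "\<exists>i. 1 \<le> i \<and> i \<le> n \<and> m (k + int i) \<le> m k" for k
  proof -
    obtain i' i where "i' < i" and i: "i \<le> n" "tight n a y k i" using two[of k] by blast
    then have "i \<ge> 1" by simp
    note i = this i
    have "m (k + int i) \<le> m k"
      using m_le[of 0 "k + int i"] m_eq[OF i(3)] abs_a[OF i(2)] a0 by (simp add: add_ac)
    with i show ?thesis by blast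
  qed
  \<comment> \<open>Symmetrically, the position of a tight \<open>i < n\<close> is index
    \<open>n\<close> of the window at \<open>k - (n - i)\<close>, with coefficient
    \<open>a n = 0\<close>.\<close>
  have down_jump: "\<exists>i. 1 \<le> i \<and> i \<le> n \<and> m (k - int i) \<le> m k" for k
  proof -
    obtain i where i: "i < n" "tight n a y k i" using two[of k] by (meson less_le_trans)
    have "int n + (k - int (n - i)) = int i + k" using i by simp
    then have "m (k - int (n - i)) \<le> m k"
      using m_le[of n "k - int (n - i)"] m_eq[OF i(2)] abs_a(1)[of i] an i by (simp add: add.commute)
    with i show ?thesis by (intro exI[of _ "n - i"]) auto
  qed
  \<comment> \<open>Jumps of length at most \<open>n\<close> are free; they are repeated until at
    most \<open>n\<close> unit steps remain, each costing at most \<open>M\<close>.\<close>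
  have up_far: "m (k + int t) \<le> m k + real n * real_of_int M" for k t
  proof (induction t arbitrary: k rule: less_induct)
    case (less t)
    show ?case
    proof (cases "t \<le> n")
      case True
      then have "real t * real_of_int M \<le> real n * real_of_int M" using M by (intro mult_right_mono) auto
      with up[of k t] show ?thesis by linarith
    next
      case False
      obtain i where i: "1 \<le> i" "i \<le> n" "m (k + int i) \<le> m k" using up_jump by blast
      with False have "m (k + int i + int (t - i)) \<le> m (k + int i) + real n * real_of_int M" by (intro less) auto
      moreover have "k + int i + int (t - i) = k + int t" using False i by simp
      ultimately show ?thesis using i by simp
    qed
  qed
  have down_far: "m (k - int t) \<le> m k + real n * real_of_int M" for k t
  proof (induction t arbitrary: k rule: less_induct)
    case (less t)
    show ?case
    proof (cases "t \<le> n")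
      case True
      then have "real t * real_of_int M \<le> real n * real_of_int M" using M by (intro mult_right_mono) auto
      with down[of k t] show ?thesis by linarith
    next
      case False
      obtain i where i: "1 \<le> i" "i \<le> n" "m (k - int i) \<le> m k" using down_jump by blast
      with False have "m (k - int i - int (t - i)) \<le> m (k - int i) + real n * real_of_int M" by (intro less) auto
      moreover have "k - int i - int (t - i) = k - int t" using False i by simp
      ultimately show ?thesis using i by simp
    qed
  qed
  have far: "m k \<le> m k' + real n * real_of_int M" for k k'
    using up_far[of k' "nat (k - k')"] down_far[of k' "nat (k' - k)"] by (cases "k \<ge> k'") auto
  \<comment> \<open>By minimality \<open>y j\<close> equals a window minimum up to one coefficient;
    this contributes one further \<open>M\<close> to the bound.\<close>
  have "\<exists>k. m k - real_of_int M \<le> y j \<and> y j \<le> m k" for j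
  proof -
    obtain i where i: "i \<le> n" "tight n a y (j - int n + int i) (n - i)"
      using assms unfolding solution_iff by blast
    have "int (n - i) + (j - int n + int i) = j" using i by simp
    then have "m (j - int n + int i) = real_of_int (a (n - i)) + y j" using m_eq[OF i(2)] by simp
    then show ?thesis using abs_a[of "n - i"] by (intro exI[of _ "j - int n + int i"]) linarith
  qed
  then obtain k k' where "y j \<le> m k" "m k' - real_of_int M \<le> y j'" by meson
  with far[of k k'] show ?thesis by (simp add: algebra_simps)
qed

lemma solution_to_nat:
  assumes "solution n a y"
  obtains z :: "int \<Rightarrow> nat" and c where "solution n a (\<lambda>j. real (z j))"
    "\<And>j. int (z j) < 1 + (int n + 1) * M" "\<And>j. \<lfloor>y j + t\<rfloor> = int (z j) + c"
proof -
  define u where "u j = \<lfloor>y j + t\<rfloor>" for j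
  define C where "C = M * (int n + 1)"
  have sol: "solution n a (\<lambda>j. real_of_int (u j))" unfolding u_def by (rule solution_floor[OF assms])
  have diff: "u j - u j' \<le> C" for j j'
  proof -
    have "real_of_int (u j - u j') \<le> real_of_int C"
      using solution_bounded[OF sol, of j j'] by (simp add: C_def)
    then show ?thesis by linarith
  qed
  \<comment> \<open>By \<open>diff\<close> the argument of \<open>nat\<close> is never negative, so
    nothing is truncated and \<open>u\<close> attains its minimum at \<open>j0\<close>.\<close>
  obtain j0 where j0: "\<And>j. nat (u j0 - u 0 + C) \<le> nat (u j - u 0 + C)"
    using ex_has_least_nat[of "\<lambda>_. True" 0 "\<lambda>j. nat (u j - u 0 + C)"] by blast
  have least: "u j0 \<le> u j" for j
    using j0[of j] diff[of 0 j] diff[of 0 j0] by linarith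
  define z where "z j = nat (u j - u j0)" for j
  have z: "u j = int (z j) + u j0" for j using least[of j] by (simp add: z_def)
  show thesis
  proof (rule that[of z "u j0"])
    have eq: "(\<lambda>j. real_of_int (u j)) = (\<lambda>j. real (z j) + real_of_int (u j0))"
    proof
      fix j show "real_of_int (u j) = real (z j) + real_of_int (u j0)"
        using arg_cong[OF z[of j], of real_of_int] by simp
    qed
    have "solution n a (\<lambda>j. real (z j) + real_of_int (u j0))"
      by (rule subst[OF eq, of "solution n a"]) (rule sol)
    then show "solution n a (\<lambda>j. real (z j))" by (simp only: solution_add_const)
    show "int (z j) < 1 + (int n + 1) * M" for j
      using diff[of j j0] z[of j] by (simp add: C_def mult.commute)
    show "\<lfloor>y j + t\<rfloor> = int (z j) + u j0" for j using z[of j] by (simp add: u_def)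
  qed
qed

end

section \<open>Words and walks\<close>

text \<open>The first letter is the least significant digit. For letters below \<open>b\<close>,
  dropping the first letter is division by \<open>b\<close>, dropping the last is reduction modulo a
  power of \<open>b\<close>.\<close>

definition code :: "nat \<Rightarrow> (int \<Rightarrow> nat) \<Rightarrow> nat \<Rightarrow> int \<Rightarrow> nat" where
  "code b z m p = (\<Sum>i<m. z (p + int i) * b ^ i)"

lemma code_Suc_left: "code b z (Suc m) p = z p + b * code b z m (p + 1)"
  unfolding code_def
  by (subst sum.lessThan_Suc_shift) (simp add: sum_distrib_left algebra_simps)

lemma code_Suc_right: "code b z (Suc m) p = code b z m p + z (p + int m) * b ^ m"
  by (simp add: code_def)

lemma code_less:
  assumes "\<And>p. z p < b"
  shows "code b z m p < b ^ m"
proof (induction m)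
  case (Suc m)
  have "(z (p + int m) + 1) * b ^ m \<le> b * b ^ m"
    using assms[of "p + int m"] by (intro mult_le_mono1) simp
  with Suc show ?case by (simp add: code_Suc_right)
qed (simp add: code_def)

lemma digit_code:
  assumes "\<And>p. z p < b" "i < m"
  shows "digit b (code b z m p) i = z (p + int i)"
  using \<open>i < m\<close>
proof (induction i arbitrary: m p)
  case 0
  then obtain m' where "m = Suc m'" by (cases m) auto
  then show ?case using assms(1)[of p] by (simp add: digit_def code_Suc_left)
next
  case (Suc i)
  then obtain m' where m': "m = Suc m'" "i < m'" by (cases m) auto
  have "code b z m p div b = code b z m' (p + 1)"
    using assms(1)[of p] by (simp add: m' code_Suc_left)
  then have "digit b (code b z m p) (Suc i) = digit b (code b z m' (p + 1)) i"
    by (simp add: digit_def div_mult2_eq)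
  then show ?case using Suc.IH[OF m'(2), of "p + 1"] by (simp add: add_ac)
qed

lemma sum_of_bool_ge_1: "(1::int) \<le> (\<Sum>i<(m::nat). of_bool (P i)) \<longleftrightarrow> (\<exists>i<m. P i)"
proof -
  have eq: "(\<Sum>i<m. of_bool (P i) :: int) = int (card {i. i < m \<and> P i})"
    by (simp add: Collect_conj_eq lessThan_def)
  moreover have "card {i. i < m \<and> P i} = 0 \<longleftrightarrow> {i. i < m \<and> P i} = {}" by (rule card_0_eq) simp
  moreover have "{i. i < m \<and> P i} = {} \<longleftrightarrow> \<not> (\<exists>i<m. P i)" by blast
  moreover have "1 \<le> int (card {i. i < m \<and> P i}) \<longleftrightarrow> card {i. i < m \<and> P i} \<noteq> 0" by linarith
  ultimately show ?thesis unfolding eq by blast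
qed

lemma card_ge_2_iff:
  "2 \<le> card {i. i < (m::nat) \<and> P i} \<longleftrightarrow> (\<exists>i<m. \<exists>j<m. i \<noteq> j \<and> P i \<and> P j)"
proof -
  have "2 \<le> card {i. i < m \<and> P i} \<longleftrightarrow> \<not> card {i. i < m \<and> P i} \<le> Suc 0" by linarith
  also have "\<dots> \<longleftrightarrow> (\<exists>i<m. \<exists>j<m. i \<noteq> j \<and> P i \<and> P j)"
    by (subst card_le_Suc0_iff_eq) auto
  finally show ?thesis .
qed

lemma sum_of_bool_ge_2: "(2::int) \<le> (\<Sum>i<(m::nat). of_bool (P i)) \<longleftrightarrow> (\<exists>i<m. \<exists>j<m. i \<noteq> j \<and> P i \<and> P j)"
proof -
  have eq: "(\<Sum>i<m. of_bool (P i) :: int) = int (card {i. i < m \<and> P i})"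
    by (simp add: Collect_conj_eq lessThan_def)
  show ?thesis unfolding eq card_ge_2_iff[symmetric] by linarith
qed

text \<open>For each \<open>p\<close> the two sums in \<open>valid_word\<close> express the two
  conditions of \<open>solution_iff\<close> at \<open>k = p\<close>; real and integer comparisons
  agree since all values are integral.\<close>

lemma solution_iff_valid_word:
  assumes "\<And>p i. i \<le> 2 * n \<Longrightarrow> digit b (W p) i = z (p + int i)"
  shows "solution n a (\<lambda>j. real (z j)) \<longleftrightarrow> (\<forall>p. valid_word n a b (W p))"
proof -
  let ?y = "\<lambda>j. real (z j)"
  have tight: "(\<forall>l\<le>n. a i + int (digit b (W p) (k + i)) \<le> a l + int (digit b (W p) (k + l))) \<longleftrightarrow>
      tight n a ?y (p + int k) i" if "k \<le> n" "i \<le> n" for p k i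
  proof -
    have "a i + int (z (p + int (k + i))) \<le> a l + int (z (p + int (k + l))) \<longleftrightarrow>
      real_of_int (a i) + ?y (int i + (p + int k)) \<le> real_of_int (a l) + ?y (int l + (p + int k))" for l
    proof -
      have "p + int (k + i) = int i + (p + int k)" "p + int (k + l) = int l + (p + int k)" by auto
      moreover have "x + int u \<le> x' + int u' \<longleftrightarrow> real_of_int x + real u \<le> real_of_int x' + real u'" for x x' u u'
        by (metis of_int_add of_int_le_iff of_int_of_nat_eq)
      ultimately show ?thesis by (simp only:)
    qed
    then show ?thesis using that by (simp add: assms tight_def)
  qed
  have "valid_word n a b (W p) \<longleftrightarrow> (\<exists>i j. i \<noteq> j \<and> tight n a ?y p i \<and> tight n a ?y p j) \<and>
     (\<exists>i\<le>n. tight n a ?y (p + int i) (n - i))" for p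
  proof -
    have "(\<exists>i<n + 1. \<exists>j<n + 1. i \<noteq> j \<and> (\<forall>l\<le>n. a i + int (digit b (W p) i) \<le> a l + int (digit b (W p) l)) \<and>
      (\<forall>l\<le>n. a j + int (digit b (W p) j) \<le> a l + int (digit b (W p) l))) \<longleftrightarrow>
      (\<exists>i j. i \<noteq> j \<and> tight n a ?y p i \<and> tight n a ?y p j)"
    proof -
      have "(\<forall>l\<le>n. a i + int (digit b (W p) i) \<le> a l + int (digit b (W p) l)) \<longleftrightarrow> tight n a ?y p i"
        if "i < n + 1" for i using tight[of 0 i p] that by simp
      moreover have "i < n + 1" if "tight n a ?y p i" for i using that by (simp add: tight_def)
      ultimately show ?thesis by blast
    qed
    moreover have "(\<forall>l\<le>n. a (n - k) + int (digit b (W p) n) \<le> a l + int (digit b (W p) (k + l))) \<longleftrightarrow>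
        tight n a ?y (p + int k) (n - k)" if "k < n + 1" for k
      using tight[of k "n - k" p] that by simp
    ultimately show ?thesis
      unfolding valid_word_def sum_of_bool_ge_1 sum_of_bool_ge_2 by (auto simp: less_Suc_eq_le)
  qed
  then show ?thesis by (simp add: solution_iff)
qed

lemma periodic_multiple:
  assumes "\<And>j::int. y (j + d) = y j"
  shows "y (j + int k * d) = y j"
proof (induction k)
  case (Suc k)
  have "y (j + int (Suc k) * d) = y (j + int k * d + d)" by (simp add: algebra_simps)
  also have "\<dots> = y (j + int k * d)" by (rule assms)
  finally show ?case using Suc by simp
qed simp

section \<open>The de Bruijn graph of words and its bi-infinite walks\<close>

locale decision = params n M a b K N Z + tropical n M a
  for n :: nat and M :: int and a :: "nat \<Rightarrow> int" and b K N Z :: nat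
begin

lemma N_eq: "N = K * b" by (simp add: N K)

lemma in_ins_iff: "w \<in> arith_seq (x * b) 1 \<longleftrightarrow> w div b = x"
proof
  assume "w div b = x"
  then have "w = x * b + w mod b * 1" by (metis div_mult_mod_eq mult.right_neutral)
  moreover have "w mod b < b" using b_pos by simp
  ultimately show "w \<in> arith_seq (x * b) 1" unfolding arith_seq_def by blast
qed (auto simp: arith_seq_def)

lemma in_outs_iff: "x < K \<Longrightarrow> w \<in> arith_seq x K \<longleftrightarrow> w < N \<and> w mod K = x"
proof
  assume "x < K" "w < N \<and> w mod K = x"
  then have "w = x + w div K * K" by (metis add.commute div_mult_mod_eq)
  moreover have "w div K < b"
    using \<open>w < N \<and> w mod K = x\<close> by (simp add: N_eq less_mult_imp_div_less mult.commute)
  ultimately show "w \<in> arith_seq x K" unfolding arith_seq_def by blast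
next
  assume "x < K" "w \<in> arith_seq x K"
  then show "w < N \<and> w mod K = x" using arith_seq_less(2)[of x] by (auto simp: arith_seq_def)
qed

text \<open>De Bruijn adjacency: \<open>w\<close> without its first letter is \<open>w'\<close>
  without its last.\<close>

definition edge :: "nat \<Rightarrow> nat \<Rightarrow> bool" where
  "edge w w' \<longleftrightarrow> w div b = w' mod K"

text \<open>The successors of \<open>w\<close> are the words beginning with the overlap
  \<open>w div b\<close>, its predecessors those ending in \<open>w mod K\<close>. Balance at these
  two overlaps supplies a neighbour on either side, and neighbours on either side give
  balance.\<close>

lemma balanced_iff:
  assumes "A \<subseteq> {..<N}"
  shows "balanced A \<longleftrightarrow> (\<forall>w\<in>A. (\<exists>w'\<in>A. edge w w') \<and> (\<exists>w'\<in>A. edge w' w))"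
proof -
  have K: "K > 0" using b_pos by (simp add: K)
  have "balanced A \<longleftrightarrow> (\<forall>x<K. (\<exists>w\<in>A. w div b = x) \<longleftrightarrow> (\<exists>w\<in>A. w mod K = x))"
  proof -
    have "(arith_seq (x * b) 1 \<inter> A = {} \<longleftrightarrow> arith_seq x K \<inter> A = {}) \<longleftrightarrow>
      ((\<exists>w\<in>A. w div b = x) \<longleftrightarrow> (\<exists>w\<in>A. w mod K = x))" if "x < K" for x
    proof -
      have "arith_seq (x * b) 1 \<inter> A = {} \<longleftrightarrow> \<not> (\<exists>w\<in>A. w div b = x)"
        using in_ins_iff[of _ x] by blast
      moreover have "arith_seq x K \<inter> A = {} \<longleftrightarrow> \<not> (\<exists>w\<in>A. w mod K = x)"
        using in_outs_iff[OF that] assms by blast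
      ultimately show ?thesis by argo
    qed
    then show ?thesis unfolding balanced_def by meson
  qed
  also have "\<dots> \<longleftrightarrow> (\<forall>w\<in>A. (\<exists>w'\<in>A. edge w w') \<and> (\<exists>w'\<in>A. edge w' w))"
  proof -
    have less: "w div b < K" "w mod K < K" if "w \<in> A" for w
    proof -
      have "w < K * b" using assms that by (auto simp: N_eq)
      then show "w div b < K" by (rule less_mult_imp_div_less)
      show "w mod K < K" using K by (rule mod_less_divisor)
    qed
    show ?thesis
    proof (rule iffI; intro ballI allI impI)
      fix w
      assume "\<forall>x<K. (\<exists>w\<in>A. w div b = x) \<longleftrightarrow> (\<exists>w\<in>A. w mod K = x)" and w: "w \<in> A"
      then have "\<exists>w'\<in>A. w' mod K = w div b" "\<exists>w'\<in>A. w' div b = w mod K"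
        using less[OF w] by blast+
      then show "(\<exists>w'\<in>A. edge w w') \<and> (\<exists>w'\<in>A. edge w' w)" unfolding edge_def by metis
    next
      fix x
      assume edges: "\<forall>w\<in>A. (\<exists>w'\<in>A. edge w w') \<and> (\<exists>w'\<in>A. edge w' w)"
      show "(\<exists>w\<in>A. w div b = x) \<longleftrightarrow> (\<exists>w\<in>A. w mod K = x)"
        using edges unfolding edge_def by metis
    qed
  qed
  finally show ?thesis .
qed

definition walk :: "nat set \<Rightarrow> (int \<Rightarrow> nat) \<Rightarrow> bool" where
  "walk A W \<longleftrightarrow> (\<forall>p. W p \<in> A \<and> edge (W p) (W (p + 1)))"

text \<open>Without dead ends, dependent choice extends \<open>w\<close> into the future and into
  the past; the two halves are glued at position 0.\<close>

lemma walk_through: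
  assumes "A \<subseteq> {..<N}" "balanced A" "w \<in> A"
  obtains W where "walk A W" "W 0 = w"
proof -
  have ex: "\<exists>w'. w' \<in> A \<and> edge w w'" "\<exists>w'. w' \<in> A \<and> edge w' w" if "w \<in> A" for w
    using assms(2) that unfolding balanced_iff[OF assms(1)] by blast+
  have "\<exists>f. \<forall>j. (f j \<in> A \<and> (j = 0 \<longrightarrow> f j = w)) \<and> edge (f j) (f (Suc j))"
    by (rule dependent_nat_choice) (use ex assms in auto)
  then obtain f where f: "\<And>j. f j \<in> A" "f 0 = w" "\<And>j. edge (f j) (f (Suc j))" by blast
  have "\<exists>g. \<forall>j. (g j \<in> A \<and> (j = 0 \<longrightarrow> g j = w)) \<and> edge (g (Suc j)) (g j)"
    by (rule dependent_nat_choice) (use ex assms in auto)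
  then obtain g where g: "\<And>j. g j \<in> A" "g 0 = w" "\<And>j. edge (g (Suc j)) (g j)" by blast
  define W where "W p = (if p \<ge> 0 then f (nat p) else g (nat (- p)))" for p
  have "edge (W p) (W (p + 1))" for p
  proof (cases "p \<ge> 0")
    case True
    then show ?thesis using f(3)[of "nat p"] by (simp add: W_def nat_add_distrib)
  next
    case False
    \<comment> \<open>The seam is \<open>p = -1\<close>: there the right neighbour is
      \<open>f 0\<close>, which equals \<open>g 0\<close>.\<close>
    have "g (nat (- (p + 1))) = W (p + 1)" using False f(2) g(2) by (auto simp: W_def)
    moreover have "Suc (nat (- (p + 1))) = nat (- p)" using False by simp
    ultimately show ?thesis using False g(3)[of "nat (- (p + 1))"] by (simp add: W_def)
  qed
  then have "walk A W" using f(1) g(1) by (auto simp: walk_def W_def)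
  moreover have "W 0 = w" by (simp add: W_def f)
  ultimately show thesis by (rule that)
qed

lemma digit_mod: "i < m \<Longrightarrow> digit b (w mod b ^ m) i = digit b w i"
proof -
  assume "i < m"
  then obtain d where m: "m = Suc d + i" by (metis add.commute add_Suc_right less_imp_Suc_add)
  have "w = w mod b ^ m + b ^ i * (b * (b ^ d * (w div b ^ m)))"
    using mod_mult_div_eq[of w "b ^ m"] by (simp add: m power_add mult_ac)
  then have "w div b ^ i = w mod b ^ m div b ^ i + b * (b ^ d * (w div b ^ m))"
    using b_pos by (metis add.commute div_mult_self2 power_not_zero less_numeral_extra(3))
  then show ?thesis by (simp add: digit_def)
qed

text \<open>An edge identifies letter \<open>i + 1\<close> of a word with letter \<open>i\<close> of
  the next, so every letter slides to the front; the bound on \<open>i\<close> keeps it inside the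
  overlap.\<close>

lemma walk_digits:
  assumes "walk A W" "i \<le> 2 * n"
  shows "digit b (W p) i = W (p + int i) mod b"
  using assms(2)
proof (induction i arbitrary: p)
  case 0
  show ?case by (simp add: digit_def)
next
  case (Suc i)
  have "digit b (W p) (Suc i) = digit b (W p div b) i"
    by (simp add: digit_def div_mult2_eq)
  also have "W p div b = W (p + 1) mod K" using assms(1) by (simp add: walk_def edge_def)
  also have "digit b \<dots> i = digit b (W (p + 1)) i"
    unfolding K using Suc.prems by (intro digit_mod) simp
  also have "\<dots> = W (p + 1 + int i) mod b" using Suc by simp
  finally show ?case by (simp add: add_ac)
qed

section \<open>Solutions as walks; branching against a common period\<close>

definition words :: "nat set" where
  "words = {w. w < N \<and> valid_word n a b w}"

lemma words_less: "words \<subseteq> {..<N}"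
  by (auto simp: words_def)

lemma walk_solution:
  assumes "walk A W" "A \<subseteq> words"
  shows "solution n a (\<lambda>p. real (W p mod b))"
proof -
  have "\<forall>p. valid_word n a b (W p)" using assms by (auto simp: walk_def words_def)
  then show ?thesis
    using solution_iff_valid_word[of n b W "\<lambda>p. W p mod b" a] walk_digits[OF assms(1)] by blast
qed

text \<open>A walk through \<open>w\<close> gets a second past, one that arrives at
  \<open>w'\<close>. The two walks agree from position 1 on but differ at position 0, which is
  impossible if both sequences are periodic.\<close>

lemma branching_imp_nonperiodic:
  assumes A: "A \<subseteq> words" "balanced A" and w: "w \<in> A" "w' \<in> A" "w \<noteq> w'" "w div b = w' div b"
  shows "\<exists>y. solution n a y \<and> \<not> periodic_seq y"
proof (rule ccontr)
  assume *: "\<not> ?thesis"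
  have AN: "A \<subseteq> {..<N}" using A words_less by blast
  obtain W where W: "walk A W" "W 0 = w" using walk_through[OF AN A(2) w(1)] .
  obtain W1 where W1: "walk A W1" "W1 0 = w'" using walk_through[OF AN A(2) w(2)] .
  define W' where "W' p = (if p \<ge> 1 then W p else W1 p)" for p
  \<comment> \<open>The regluing is legitimate because an edge depends on its source only through
    \<open>div b\<close>.\<close>
  have "edge w' (W 1)" using W w(4) unfolding walk_def edge_def by (metis add_0)
  then have "edge (W' p) (W' (p + 1))" for p
    using W(1) W1 by (cases "p = 0") (auto simp: walk_def W'_def)
  then have W': "walk A W'" using W(1) W1(1) by (auto simp: walk_def W'_def)
  define y where "y p = real (W p mod b)" for p
  define y' where "y' p = real (W' p mod b)" for p
  have "solution n a y" "solution n a y'"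
    using walk_solution W(1) W' A(1) unfolding y_def y'_def by blast+
  with * obtain d d' where d: "d \<ge> 1" "\<And>j. y (j + d) = y j" "d' \<ge> 1" "\<And>j. y' (j + d') = y' j"
    unfolding periodic_seq_def by meson
  have "y 0 = y (d' * d)" using periodic_multiple[of y d 0 "nat d'"] d by simp
  \<comment> \<open>\<open>d' * d\<close> is a multiple of both periods and at least 1, where the
    two sequences coincide.\<close>
  also have "d' * d \<ge> 1" using d by (simp add: int_one_le_iff_zero_less)
  then have "y (d' * d) = y' (d' * d)" by (simp add: y_def y'_def W'_def)
  also have "\<dots> = y' 0" using periodic_multiple[of y' d' 0 "nat d"] d by (simp add: mult.commute)
  finally have "w mod b = w' mod b" using W W1 by (simp add: y_def y'_def W'_def)
  with w show False by (metis div_mult_mod_eq)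
qed

text \<open>Consecutive codes overlap, so every word read off the solution has a neighbour on either
  side. The set of these words is balanced and therefore lies in the largest balanced set.\<close>

lemma solution_codes:
  assumes "solution n a (\<lambda>j. real (z j))" "\<And>j. z j < b"
  defines "W \<equiv> code b z (2 * n + 1)"
  shows "range W \<subseteq> words" "balanced (range W)" "edge (W p) (W (p + 1))" "W p mod b = z p"
proof -
  have less: "W p < N" for p unfolding W_def N by (rule code_less[OF assms(2)])
  have dig: "digit b (W p) i = z (p + int i)" if "i \<le> 2 * n" for p i
    unfolding W_def using that by (intro digit_code assms(2)) simp
  show 1: "range W \<subseteq> words"
    using solution_iff_valid_word[of n b W z a, OF dig] assms(1) less by (auto simp: words_def)
  show edge: "edge (W p) (W (p + 1))" for p
  proof -
    have "W p div b = code b z (2 * n) (p + 1)"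
      unfolding W_def using assms(2)[of p] by (simp add: code_Suc_left)
    moreover have "W (p + 1) mod K = code b z (2 * n) (p + 1)"
      unfolding W_def K using code_less[where m = "2 * n" and p = "p + 1", OF assms(2)] by (simp add: code_Suc_right)
    ultimately show ?thesis by (simp add: edge_def)
  qed
  have "edge (W (p - 1)) (W p)" for p using edge[of "p - 1"] by simp
  with edge show "balanced (range W)"
    using balanced_iff[of "range W"] 1 words_less by blast
  show "W p mod b = z p" using dig[of 0 p] by (simp add: digit_def)
qed

text \<open>Without branching, a code determines all earlier ones, so by the pigeonhole principle
an integer solution has a period at most \<open>N\<close> to the left of any given position.\<close>

lemma nonbranching_imp_period:
  assumes A: "\<And>G. balanced G \<Longrightarrow> G \<subseteq> words \<Longrightarrow> G \<subseteq> A"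
    and inj: "\<And>w w'. w \<in> A \<Longrightarrow> w' \<in> A \<Longrightarrow> w div b = w' div b \<Longrightarrow> w = w'"
    and z: "solution n a (\<lambda>j. real (z j))" "\<And>j. z j < b"
  shows "z (j + int (fact N)) = z j"
proof -
  define W where "W = code b z (2 * n + 1)"
  note W = solution_codes[OF z, folded W_def]
  have WA: "W p \<in> A" for p using A[OF W(2,1)] by blast
  \<comment> \<open>The offset \<open>fact N\<close> leaves room for all the translates of
    \<open>j\<close> up to \<open>j + fact N\<close> to the left of the repetition found
    below.\<close>
  define s where "s = j + int (fact N)"
  \<comment> \<open>There are \<open>N + 1\<close> positions but codes below \<open>N\<close>
    only.\<close>
  have "\<not> inj_on W {s..s + int N}"
  proof
    assume "inj_on W {s..s + int N}"
    then have "card {s..s + int N} \<le> card {..<N}"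
      by (rule card_inj_on_le) (use W(1) words_less in auto)
    then show False by simp
  qed
  then obtain p q where pq: "s \<le> p" "p < q" "q \<le> s + int N" "W p = W q"
    unfolding inj_on_def by (metis atLeastAtMost_iff linorder_neqE_linordered_idom)
  have earlier: "W (p - int i) = W (q - int i)" for i
  proof (induction i)
    case (Suc i)
    have "W (p - int (Suc i)) div b = W (q - int (Suc i)) div b"
      using W(3)[of "p - int (Suc i)"] W(3)[of "q - int (Suc i)"] Suc by (simp add: edge_def)
    then show ?case by (rule inj[OF WA WA])
  qed (use pq in simp)
  have period: "z (i + (q - p)) = z i" if "i \<le> p" for i
    using earlier[of "nat (p - i)"] that W(4)[of i] W(4)[of "i + (q - p)"] by (simp add: algebra_simps)
  \<comment> \<open>The period \<open>q - p\<close> depends on \<open>z\<close>; being at most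
    \<open>N\<close> it divides \<open>fact N\<close>, which does not.\<close>
  have "nat (q - p) dvd fact N" using pq by (intro dvd_fact) auto
  then obtain m where m: "fact N = nat (q - p) * m" by blast
  have "z (j + int k * (q - p)) = z j" if "k \<le> m" for k
    using that
  proof (induction k)
    case (Suc k)
    have "int k * (q - p) \<le> int m * (q - p)" using Suc.prems pq by (intro mult_right_mono) auto
    also have "\<dots> = int (fact N)" using m pq by (simp add: mult.commute)
    finally have "z (j + int k * (q - p) + (q - p)) = z (j + int k * (q - p))"
      using pq by (intro period) (simp add: s_def)
    with Suc show ?case by (simp add: algebra_simps)
  qed simp
  from this[of m] show ?thesis using m pq by (simp add: mult.commute)
qed

lemma nonperiodic_iff_branching:
  assumes A: "A \<subseteq> words" "balanced A" "\<And>G. balanced G \<Longrightarrow> G \<subseteq> words \<Longrightarrow> G \<subseteq> A"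
  shows "(\<exists>y. solution n a y \<and> \<not> periodic_seq y) \<longleftrightarrow> (\<exists>x<K. card {e. e < b \<and> x * b + e \<in> A} \<ge> 2)"
proof
  assume "\<exists>x<K. card {e. e < b \<and> x * b + e \<in> A} \<ge> 2"
  then obtain x e e' where "e < b" "e' < b" "e \<noteq> e'" "x * b + e \<in> A" "x * b + e' \<in> A"
    unfolding card_ge_2_iff by blast
  then show "\<exists>y. solution n a y \<and> \<not> periodic_seq y"
    by (intro branching_imp_nonperiodic[OF A(1,2), of "x * b + e" "x * b + e'"]) auto
next
  assume "\<exists>y. solution n a y \<and> \<not> periodic_seq y"
  then obtain y where y: "solution n a y" "\<not> periodic_seq y" by blast
  show "\<exists>x<K. card {e. e < b \<and> x * b + e \<in> A} \<ge> 2"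
  proof (rule ccontr)
    assume none: "\<not> ?thesis"
    \<comment> \<open>Two words of \<open>A\<close> with equal quotient \<open>x\<close> would both
      be counted at \<open>x\<close>, being \<open>x * b\<close> plus distinct remainders.\<close>
    have inj: "w = w'" if "w \<in> A" "w' \<in> A" "w div b = w' div b" for w w'
    proof (rule ccontr)
      assume "w \<noteq> w'"
      define x where "x = w div b"
      have "w < N" using A(1) that words_less by auto
      then have "x < K" by (simp add: x_def N_eq less_mult_imp_div_less)
      moreover have "x * b + w mod b \<in> A" using that(1) by (simp add: x_def)
      moreover have "x * b + w' mod b \<in> A" unfolding x_def that(3) using that(2) by simp
      moreover have "w mod b \<noteq> w' mod b" using \<open>w \<noteq> w'\<close> that(3) by (metis div_mult_mod_eq)
      moreover have "w mod b < b" "w' mod b < b" using b_pos by simp_all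
      ultimately have "x < K" "\<exists>e<b. \<exists>e'<b. e \<noteq> e' \<and> x * b + e \<in> A \<and> x * b + e' \<in> A" by blast+
      then show False using none card_ge_2_iff[of b "\<lambda>e. x * b + e \<in> A"] by blast
    qed
    \<comment> \<open>The period \<open>fact N\<close> is the same for all shifts \<open>t\<close>,
      which is what transfers it from the roundings to \<open>y\<close>.\<close>
    have floor: "\<lfloor>y (j + int (fact N)) + t\<rfloor> = \<lfloor>y j + t\<rfloor>" for j t
    proof -
      obtain z c where z: "solution n a (\<lambda>j. real (z j))" "\<And>j. int (z j) < 1 + (int n + 1) * M"
        "\<And>j. \<lfloor>y j + t\<rfloor> = int (z j) + c"
        using solution_to_nat[OF y(1)] by metis
      have less: "z j < b" for j using z(2)[of j] b by linarith
      have "z (j + int (fact N)) = z j"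
        by (rule nonbranching_imp_period[of A]) (fact A(3) inj z(1) less)+
      then show ?thesis by (simp only: z(3))
    qed
    have "y (j + int (fact N)) = y j" for j
    proof -
      \<comment> \<open>The shifts \<open>- y j\<close> and \<open>- y (j + fact N)\<close> make one
        of the two rounded values 0; the difference and its negative are then both
        nonnegative.\<close>
      have "\<lfloor>y (j + int (fact N)) - y j\<rfloor> = 0" "\<lfloor>y j - y (j + int (fact N))\<rfloor> = 0"
        using floor[of j "- y j"] floor[of j "- y (j + int (fact N))"] by simp_all
      then show ?thesis by linarith
    qed
    moreover have "int (fact N) \<ge> 1" using fact_ge_1[of N, where 'a = nat] by linarith
    ultimately show False using y(2) unfolding periodic_seq_def by blast
  qed
qed

end

section \<open>The complexity bound\<close>

lemma Z_bound:
  fixes n b :: nat and M :: int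
  assumes "n \<ge> 1" "M \<ge> 0" "int b = 1 + (int n + 1) * M"
  defines "X \<equiv> max 2 (real_of_int M * real n)"
  shows "real (b ^ (2 * n + 1) + b + 2 * n + 2) \<le> X ^ (11 * n)"
proof -
  \<comment> \<open>The base is kept at 2 or more because \<open>M * n\<close> may be 0 or 1, whose
    powers do not grow.\<close>
  have X: "X \<ge> 2" "real_of_int M * real n \<le> X" by (auto simp: X_def)
  have b: "real b = 1 + (real n + 1) * real_of_int M"
    using arg_cong[OF assms(3), of real_of_int] by simp
  have "real b \<le> X ^ 3"
  proof (cases "M = 0")
    case True
    then show ?thesis using b X one_le_power[of X 3] by simp
  next
    case False
    then have "1 \<le> real_of_int M" "1 \<le> real n" using assms by auto
    then have "1 * 1 \<le> real_of_int M * real n" "real_of_int M * 1 \<le> real_of_int M * real n"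
      by (intro mult_mono mult_left_mono; simp)+
    \<comment> \<open>Both 1 and \<open>M\<close> are at most \<open>M * n\<close>, hence so is each
      of the three terms of \<open>1 + M * n + M\<close>.\<close>
    then have "real b \<le> 3 * (real_of_int M * real n)" by (simp add: b algebra_simps)
    also have "\<dots> \<le> (2 * 2) * X" using X by simp
    also have "\<dots> \<le> (X * X) * X" using X by (intro mult_right_mono mult_mono) auto
    finally show ?thesis by (simp add: power3_eq_cube)
  qed
  have "real b ^ (2 * n + 1) \<le> (X ^ 3) ^ (2 * n + 1)" using \<open>real b \<le> X ^ 3\<close> by (intro power_mono) auto
  also have "\<dots> = X ^ (3 * (2 * n + 1))" by (simp only: power_mult)
  \<comment> \<open>Since \<open>n \<ge> 1\<close>, the exponent \<open>6 * n + 3\<close> is at most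
    \<open>9 * n\<close>.\<close>
  also have "\<dots> \<le> X ^ (9 * n)" using X assms(1) by (intro power_increasing) auto
  finally have 1: "real b ^ (2 * n + 1) \<le> X ^ (9 * n)" .
  have "X ^ 3 \<le> X ^ (9 * n)" using X assms(1) by (intro power_increasing) auto
  with \<open>real b \<le> X ^ 3\<close> have 2: "real b \<le> X ^ (9 * n)" by simp
  have "real (n + 1) \<le> 2 ^ n" using less_exp[of n] by (metis Suc_eq_plus1 Suc_leI of_nat_le_iff of_nat_numeral of_nat_power)
  also have "\<dots> \<le> X ^ n" using X by (intro power_mono) auto
  also have "\<dots> \<le> X ^ (9 * n)" using X by (intro power_increasing) auto
  finally have 3: "real (n + 1) \<le> X ^ (9 * n)" .
  \<comment> \<open>The sum is \<open>b ^ (2 * n + 1)\<close>, \<open>b\<close> and twice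
    \<open>n + 1\<close>: four terms of size at most \<open>X ^ (9 * n)\<close>. The factor 4 is
    absorbed by \<open>X ^ 2\<close>, and the exponent 2 by \<open>2 * n\<close>.\<close>
  have "real (b ^ (2 * n + 1) + b + 2 * n + 2) \<le> (2 * 2) * X ^ (9 * n)" using 1 2 3 by simp
  also have "\<dots> \<le> (X * X) * X ^ (9 * n)" using X by (intro mult_right_mono mult_mono) auto
  also have "\<dots> = X ^ (9 * n + 2)" by (simp add: power_add power2_eq_square)
  also have "\<dots> \<le> X ^ (11 * n)" using X assms(1) by (intro power_increasing) auto
  finally show ?thesis .
qed

theorem theorem2:
  shows "\<exists>(P::prog) (c::nat). \<forall>(n::nat) (M::int) (a::nat \<Rightarrow> int).
     n \<ge> 1 \<longrightarrow> M \<ge> 0 \<longrightarrow> (\<forall>i\<le>n. 0 \<le> a i \<and> a i \<le> M) \<longrightarrow> a 0 = 0 \<longrightarrow> a n = 0 \<longrightarrow>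
     (\<exists>t Rf. halts_within P (input_regs n M a) t Rf \<and>
        real t \<le> (max 2 (real_of_int M * real n)) ^ (c * n) \<and>
        (Rf 0 = 1 \<longleftrightarrow>
           (\<exists>y::int \<Rightarrow> real. satisfies n a y \<and> minimal_seq n a y \<and> \<not> periodic_seq y)))"
proof -
  obtain C d where Cd: "\<And>Z. Z \<ge> 1 \<Longrightarrow> tb Z decision_prog \<le> C * Z ^ d"
    using tb_polynomial by blast
  show ?thesis
  \<comment> \<open>The running time is at most \<open>C * Z ^ d\<close>. The constant is absorbed
    by \<open>C \<le> 2 ^ C\<close>, contributing \<open>C\<close> to the exponent factor, and
    \<open>Z \<le> X ^ (11 * n)\<close> contributes \<open>11 * d\<close>.\<close>
  proof (rule exI[of _ "compile decision_prog 0"], rule exI[of _ "C + 11 * d"], intro allI impI)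
    fix n :: nat and M :: int and a :: "nat \<Rightarrow> int"
    assume n: "n \<ge> 1" and M: "M \<ge> 0" and a: "\<forall>i\<le>n. 0 \<le> a i \<and> a i \<le> M" "a 0 = 0" "a n = 0"
    define b where "b = nat (1 + (int n + 1) * M)"
    define K where "K = b ^ (2 * n)"
    define N where "N = b ^ (2 * n + 1)"
    define Z where "Z = N + b + 2 * n + 2"
    have b: "int b = 1 + (int n + 1) * M" using M by (simp add: b_def)
    then have "b > 0" using M by (cases "b = 0") (auto simp: add_nonneg_eq_0_iff)
    interpret decision n M a b K N Z
      by unfold_locales (use n M a b \<open>b > 0\<close> in \<open>auto simp: K_def N_def Z_def\<close>)
    let ?R = "input_regs n M a"
    have R: "?R 0 = int n" "?R 1 = M" "\<forall>i\<le>n. ?R (2 + int i) = a i"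
      by (auto simp: input_regs_def)
    obtain A where A: "A \<subseteq> words" "balanced A" "\<And>G. balanced G \<Longrightarrow> G \<subseteq> words \<Longrightarrow> G \<subseteq> A"
      and wp: "wp Z decision_prog (\<lambda>R'. R' 0 = 1 \<longleftrightarrow> (\<exists>x<K. card {e. e < b \<and> x * b + e \<in> A} \<ge> 2)) ?R"
      by (rule wp_decision_prog[OF R, folded words_def]) (rule that)
    obtain t Rf where t: "halts_within (compile decision_prog 0) ?R t Rf" "t \<le> tb Z decision_prog"
      "Rf 0 = 1 \<longleftrightarrow> (\<exists>x<K. card {e. e < b \<and> x * b + e \<in> A} \<ge> 2)"
      using halts_within_compile[OF wp] by blast
    let ?X = "max 2 (real_of_int M * real n)"
    have "Z \<ge> 1" by (simp add: Z_def)
    then have "t \<le> C * Z ^ d" using t(2) Cd le_trans by blast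
    then have "real t \<le> real (C * Z ^ d)" by (simp only: of_nat_le_iff)
    then have "real t \<le> real C * real Z ^ d" by simp
    also have "\<dots> \<le> ?X ^ (C * n) * (?X ^ (11 * n)) ^ d"
    proof (intro mult_mono power_mono)
      have "real C \<le> 2 ^ C" using less_exp[of C] by (metis less_imp_le of_nat_le_iff of_nat_numeral of_nat_power)
      also have "\<dots> \<le> ?X ^ C" by (intro power_mono) auto
      also have "\<dots> \<le> ?X ^ (C * n)" using n by (intro power_increasing) auto
      finally show "real C \<le> ?X ^ (C * n)" .
      show "real Z \<le> ?X ^ (11 * n)" using Z_bound[OF n M b] by (simp add: Z_def N_def)
    qed auto
    also have "\<dots> = ?X ^ ((C + 11 * d) * n)"
    proof -
      have "(C + 11 * d) * n = C * n + 11 * n * d" by (simp add: algebra_simps)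
      then show ?thesis by (simp only: power_add power_mult)
    qed
    finally have "real t \<le> ?X ^ ((C + 11 * d) * n)" .
    moreover have "Rf 0 = 1 \<longleftrightarrow> (\<exists>y. satisfies n a y \<and> minimal_seq n a y \<and> \<not> periodic_seq y)"
      using t(3) nonperiodic_iff_branching[OF A] by (simp add: solution_def)
    ultimately show "\<exists>t Rf. halts_within (compile decision_prog 0) (input_regs n M a) t Rf \<and>
        real t \<le> ?X ^ ((C + 11 * d) * n) \<and>
        (Rf 0 = 1 \<longleftrightarrow> (\<exists>y::int \<Rightarrow> real. satisfies n a y \<and> minimal_seq n a y \<and> \<not> periodic_seq y))"
      using t(1) by blast
  qed
qed

end
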